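(* Let $T>0$, $\omega=2\pi/T$, and let $p$ be a real-valued $T$-periodic function with Fourier coefficients $\widetilde p_\ell$. Suppose that for some $\tau_0>0$ the series $\sum_{\ell\in\mathbb Z}|\widetilde p_\ell|\,\rho_{\tau_0}(\ell)$ converges. Then the operator $H(s)$ on $\ell^2(\mathbb Z)$ with matrix $$[H(s)]_{n,m}=B\big(\tfrac12-i\omega n-is,\ \tfrac12+i\omega m+is\big)\,\widetilde p_{n-m},\quad n,m\in\mathbb Z,$$ is a trace class valued analytic function of $s\in K_{\tau_0,0}$. Moreover, for every $\delta>0$ there is a constant $C$ depending only on $\tau_0$ and $\delta$ (for the fixed $T$) such that $$\|H(s)\|_{\mathbf S_1}\le C\sum_{\ell\in\mathbb Z}|\widetilde p_\ell|\,\rho_{\tau_0}(\ell)\quad\text{for all } s\in K_{\tau_0,\delta}.$$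
   Context: $\widetilde p_\ell=\frac1T\int_0^T e^{-i\ell\omega x}p(x)\,dx$; $B(z_1,z_2)=\Gamma(z_1)\Gamma(z_2)/\Gamma(z_1+z_2)$; $\|\cdot\|_{\mathbf S_1}$ is the trace norm. $\Lambda=\{\omega n+i(m+\frac12):n,m\in\mathbb Z\}$ (the matrix entries are defined for $s\notin\Lambda$). For $\tau>0$, $\delta\ge0$, $K_{\tau,\delta}=\{s\in\mathbb C:|\operatorname{Im}s|<\tau,\ \operatorname{dist}(s,\Lambda)>\delta\}$. With $\langle n\rangle=\sqrt{1+n^2}$, the weight $\rho_\tau$ on $\mathbb Z$ is $\rho_\tau(n)=\langle n\rangle^{1/2}$ if $|\tau|<1$, $\rho_\tau(n)=\langle n\rangle^{1/2}\log(2+n^2)$ if $|\tau|=1$, and $\rho_\tau(n)=\langle n\rangle^{|\tau|-1/2}$ if $|\tau|>1$. *)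

theory Defs
  imports "HOL-Analysis.Analysis"
begin

definition omega :: "real \<Rightarrow> real" where
  "omega T = 2 * pi / T"

definition fcoef :: "real \<Rightarrow> (real \<Rightarrow> real) \<Rightarrow> int \<Rightarrow> complex" where
  "fcoef T p l = (1 / complex_of_real T) *
     integral {0..T} (\<lambda>x. exp (- (\<i> * of_int l * of_real (omega T) * of_real x)) * of_real (p x))"

definition jbr :: "int \<Rightarrow> real" where
  "jbr n = sqrt (1 + (real_of_int n)\<^sup>2)"

definition rho :: "real \<Rightarrow> int \<Rightarrow> real" where
  "rho \<tau> n = (if \<bar>\<tau>\<bar> < 1 then sqrt (jbr n)
              else if \<bar>\<tau>\<bar> = 1 then sqrt (jbr n) * ln (2 + (real_of_int n)\<^sup>2)
              else jbr n powr (\<bar>\<tau>\<bar> - 1/2))"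

definition Lam :: "real \<Rightarrow> complex set" where
  "Lam T = {complex_of_real (omega T * of_int n) + \<i> * (of_int m + 1/2) | n m :: int. True}"

definition Kset :: "real \<Rightarrow> real \<Rightarrow> real \<Rightarrow> complex set" where
  "Kset T \<tau> \<delta> = {s. \<bar>Im s\<bar> < \<tau> \<and> infdist s (Lam T) > \<delta>}"

definition Hmat :: "real \<Rightarrow> (real \<Rightarrow> real) \<Rightarrow> complex \<Rightarrow> int \<Rightarrow> int \<Rightarrow> complex" where
  "Hmat T p s n m = Beta (1/2 - \<i> * of_real (omega T) * of_int n - \<i> * s)
                         (1/2 + \<i> * of_real (omega T) * of_int m + \<i> * s) * fcoef T p (n - m)"

definition supp :: "(int \<Rightarrow> complex) \<Rightarrow> int set" where
  "supp v = {n. v n \<noteq> 0}"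

definition ip :: "(int \<Rightarrow> complex) \<Rightarrow> (int \<Rightarrow> complex) \<Rightarrow> complex" where
  "ip u v = (\<Sum>n\<in>supp u \<inter> supp v. cnj (u n) * v n)"

definition mform :: "(int \<Rightarrow> int \<Rightarrow> complex) \<Rightarrow> (int \<Rightarrow> complex) \<Rightarrow> (int \<Rightarrow> complex) \<Rightarrow> complex" where
  "mform M e f = (\<Sum>n\<in>supp f. \<Sum>m\<in>supp e. cnj (f n) * M n m * e m)"

definition orthonormal_fam :: "nat \<Rightarrow> (nat \<Rightarrow> int \<Rightarrow> complex) \<Rightarrow> bool" where
  "orthonormal_fam N e \<longleftrightarrow> (\<forall>k<N. finite (supp (e k))) \<and>
      (\<forall>j<N. \<forall>k<N. ip (e j) (e k) = (if j = k then 1 else 0))"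

text \<open>Trace norm of the operator with matrix M:
  ||A||_{S1} = sup over orthonormal families (e_k),(f_k) of sum_k |<A e_k, f_k>|
  (finite families of finitely supported vectors suffice by density).
  Value infinity means: not trace class.\<close>
definition trace_norm :: "(int \<Rightarrow> int \<Rightarrow> complex) \<Rightarrow> ereal" where
  "trace_norm M = (SUP (N, e, f) \<in> {(N, e, f). orthonormal_fam N e \<and> orthonormal_fam N f}.
                     ereal (\<Sum>k<N. cmod (mform M (e k) (f k))))"

definition trace_class :: "(int \<Rightarrow> int \<Rightarrow> complex) \<Rightarrow> bool" where
  "trace_class M \<longleftrightarrow> trace_norm M < \<infinity>"

definition trace_class_analytic_on ::
    "(complex \<Rightarrow> int \<Rightarrow> int \<Rightarrow> complex) \<Rightarrow> complex set \<Rightarrow> bool" where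
  "trace_class_analytic_on H U \<longleftrightarrow>
     (\<forall>s\<in>U. trace_class (H s) \<and>
        (\<exists>D. ((\<lambda>z. trace_norm (\<lambda>n m. (H z n m - H s n m) / (z - s) - D n m))
               \<longlongrightarrow> 0) (at s)))"

end

theory Submission
  imports Defs "HOL-Complex_Analysis.Cauchy_Integral_Formula"
begin

text \<open>
  The trace norm of a matrix is at most the sum of the absolute values of its entries, so it is
  enough to sum the entries of \<open>H(s)\<close> along each diagonal \<open>n - m = l\<close>. With
  \<open>s = \<sigma> + i u\<close>, \<open>a = \<omega> n + \<sigma>\<close> and \<open>b = \<omega> m + \<sigma>\<close>, the vertical decay of the Gamma
  function bounds the Beta factor by a constant times
  \<open>(1 + \<bar>l\<bar>)^(-1/2) ((1 + \<bar>a\<bar>) / (1 + \<bar>b\<bar>))^u exp (- \<pi> (\<bar>a\<bar> + \<bar>b\<bar> - \<omega> \<bar>l\<bar>) / 2)\<close>.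
  The exponential cuts the sum over the diagonal down to about \<open>\<bar>l\<bar>\<close> terms, and the remaining power
  sum is of size \<open>\<rho>(l)\<close>. The same majorant is locally uniform in \<open>s\<close>, so Cauchy estimates on the
  entries give convergence of the difference quotients in the entrywise norm.
\<close>

section \<open>The Gamma function on vertical strips\<close>

text \<open>The first term is at most 4. The later ones are dominated by the telescoping differences
  \<open>1 / (k + 1) - 1 / (k + 2)\<close>, because \<open>x + k + 1 \<ge> k + 3/2\<close>, and add
  at most 1.\<close>

lemma sum_inverse_squares_shifted_le:
  fixes x :: real
  assumes "x \<ge> 1/2"
  shows "(\<Sum>n<m. 1 / (x + real n)\<^sup>2) \<le> 5"
proof -
  have *: "(\<Sum>n<Suc m. 1 / (x + real n)\<^sup>2) \<le> 5 - 1 / (real m + 1)" for m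
  proof (induction m)
    case 0
    have "1 / x\<^sup>2 \<le> 1 / (1/2)\<^sup>2"
      using assms by (intro divide_left_mono power_mono) auto
    then show ?case by (simp add: power2_eq_square)
  next
    case (Suc m)
    have "(real m + 1) * (real m + 2) \<le> (real m + 3/2)\<^sup>2"
      by (simp add: power2_eq_square algebra_simps)
    also have "\<dots> \<le> (x + real (Suc m))\<^sup>2"
      using assms by (intro power_mono) auto
    finally have "1 / (x + real (Suc m))\<^sup>2 \<le> 1 / ((real m + 1) * (real m + 2))"
      using assms by (intro divide_left_mono) (auto intro!: mult_pos_pos)
    also have "\<dots> = 1 / (real m + 1) - 1 / (real m + 2)"
      by (simp add: field_simps)
    finally show ?case using Suc.IH by (simp add: add_ac)
  qed
  have "(\<Sum>n<m. 1 / (x + real n)\<^sup>2) \<le> (\<Sum>n<Suc m. 1 / (x + real n)\<^sup>2)"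
    by simp
  also have "\<dots> \<le> 5 - 1 / (real m + 1)" by (rule *)
  also have "\<dots> \<le> 5" by simp
  finally show ?thesis .
qed

text \<open>The squared ratio of the two moduli is \<open>1 + q\<close>, and
  \<open>ln (1 + q) \<le> q\<close>. Here \<open>q\<close> is \<open>2 * Re (inverse w)\<close> plus
  a quadratic remainder, which is summable along \<open>w = z + n\<close>.\<close>

lemma ln_cmod_add_one_le:
  fixes w :: complex
  assumes "Re w > 0"
  shows "ln (cmod (w + 1)) - ln (cmod w) \<le> Re (inverse w) + 1 / (2 * (Re w)\<^sup>2)"
proof -
  have w: "w \<noteq> 0" "w + 1 \<noteq> 0" using assms by (auto simp: complex_eq_iff)
  have pos: "cmod w > 0" "cmod (w+1) > 0" using w by simp_all
  define q where "q = (2 * Re w + 1) / (cmod w)\<^sup>2"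
  have q: "q \<ge> 0" unfolding q_def using assms by simp
  have "(cmod (w+1))\<^sup>2 = (cmod w)\<^sup>2 + (2 * Re w + 1)"
    unfolding cmod_power2 by (simp add: power2_eq_square algebra_simps)
  then have eq: "(cmod (w+1))\<^sup>2 = (cmod w)\<^sup>2 * (1 + q)"
    using pos by (simp add: q_def field_simps)
  have "2 * ln (cmod (w+1)) = ln ((cmod (w+1))\<^sup>2)"
    using pos by (simp add: ln_realpow)
  also have "\<dots> = 2 * ln (cmod w) + ln (1 + q)"
    using pos q unfolding eq by (simp add: ln_mult ln_realpow)
  finally have "2 * (ln (cmod (w+1)) - ln (cmod w)) = ln (1 + q)" by simp
  also have "\<dots> \<le> q" using q by (rule ln_add_one_self_le_self)
  also have "q = 2 * Re (inverse w) + 1 / (cmod w)\<^sup>2"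
    unfolding q_def by (simp add: add_divide_distrib cmod_power2)
  also have "1 / (cmod w)\<^sup>2 \<le> 1 / (Re w)\<^sup>2"
    using assms pos by (intro divide_left_mono mult_pos_pos) (auto simp: abs_Re_le_cmod intro!: power_mono complex_Re_le_cmod)
  finally show ?thesis by (simp add: field_simps)
qed

text \<open>Compare the partial sums of the series for the digamma function with the telescoping sum of
  \<open>ln (cmod (z + n + 1)) - ln (cmod (z + n))\<close>.\<close>
lemma Re_Digamma_le:
  fixes z :: complex
  assumes "Re z \<ge> 1/2"
  shows "Re (Digamma z) \<le> ln (cmod z) + 5/2"
proof -
  have z: "z \<noteq> 0" using assms by auto
  have lim: "(\<lambda>m. Re (of_real (ln (real m)) - (\<Sum>n<m. inverse (z + of_nat n)))) \<longlonglongrightarrow> Re (Digamma z)"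
    by (intro tendsto_Re Digamma_LIMSEQ z)
  have "Re (of_real (ln (real m)) - (\<Sum>n<m. inverse (z + of_nat n))) \<le> ln (cmod z) + 5/2"
    if "m \<ge> 1" for m
  proof -
    have "ln (cmod (z + of_nat m)) - ln (cmod z) =
        (\<Sum>n<m. ln (cmod (z + of_nat (Suc n))) - ln (cmod (z + of_nat n)))"
      by (subst sum_lessThan_telescope) simp
    also have "\<dots> \<le> (\<Sum>n<m. Re (inverse (z + of_nat n)) + 1/2 * (1 / (Re z + real n)\<^sup>2))"
    proof (rule sum_mono)
      fix n
      have "Re (z + of_nat n) > 0" using assms by (simp add: add_pos_nonneg)
      from ln_cmod_add_one_le[OF this]
      show "ln (cmod (z + of_nat (Suc n))) - ln (cmod (z + of_nat n))
          \<le> Re (inverse (z + of_nat n)) + 1/2 * (1 / (Re z + real n)\<^sup>2)"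
        by (simp add: add_ac del: inverse_complex.simps)
    qed
    also have "\<dots> = Re (\<Sum>n<m. inverse (z + of_nat n)) + 1/2 * (\<Sum>n<m. 1 / (Re z + real n)\<^sup>2)"
      by (simp only: sum.distrib sum_distrib_left Re_sum)
    also have "\<dots> \<le> Re (\<Sum>n<m. inverse (z + of_nat n)) + 5/2"
      using sum_inverse_squares_shifted_le[OF assms, of m] by simp
    finally have 1: "ln (cmod (z + of_nat m)) - ln (cmod z) \<le> Re (\<Sum>n<m. inverse (z + of_nat n)) + 5/2" .
    \<comment> \<open>Only an upper bound is wanted, so \<open>ln m\<close> may be replaced by the
      larger \<open>ln (cmod (z + m))\<close>, the end of the telescoping sum.\<close>
    have "real m \<le> Re (z + of_nat m)" using assms by simp
    also have "\<dots> \<le> cmod (z + of_nat m)" by (rule complex_Re_le_cmod)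
    finally have "ln (real m) \<le> ln (cmod (z + of_nat m))"
      using that by (intro ln_mono) auto
    with 1 show ?thesis by (simp del: Re_sum)
  qed
  then show ?thesis
    by (intro tendsto_upperbound[OF lim]) (auto intro!: eventually_sequentiallyI[of 1])
qed

text \<open>On this line \<open>1 - z = cnj z\<close>, so the reflection formula gives the squared
  modulus exactly, as \<open>pi / cosh (pi * y)\<close>.\<close>

lemma cmod_Gamma_half_le: "cmod (Gamma (Complex (1/2) y)) \<le> sqrt (2 * pi) * exp (- (pi * \<bar>y\<bar> / 2))"
proof -
  define z where "z = Complex (1/2) y"
  have z1: "1 - z = cnj z" by (simp add: z_def complex_eq_iff)
  have "of_real pi * z = of_real (pi/2) + \<i> * of_real (pi * y)"
    by (simp add: z_def complex_eq_iff)
  then have "sin (of_real pi * z) = sin (of_real (pi/2)) * cos (\<i> * of_real (pi * y)) +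
      cos (of_real (pi/2)) * sin (\<i> * of_real (pi * y))"
    by (simp only: sin_add)
  also have "\<dots> = cos (\<i> * of_real (pi * y))"
    by (simp only: sin_of_real cos_of_real sin_pi_half cos_pi_half) simp
  also have "\<dots> = of_real (cosh (pi * y))"
  proof -
    have "\<i> * (\<i> * of_real (pi * y)) = - of_real (pi * y)"
      by (simp add: complex_eq_iff)
    then show ?thesis
      unfolding cos_exp_eq by (simp add: cosh_def exp_minus flip: exp_of_real)
  qed
  finally have sin: "sin (of_real pi * z) = of_real (cosh (pi * y))" .
  have "Gamma z * Gamma (cnj z) = of_real (pi / cosh (pi * y))"
    using Gamma_reflection_complex[of z] unfolding z1 sin by simp
  then have "Gamma z * cnj (Gamma z) = of_real (pi / cosh (pi * y))"
    by (simp add: cnj_Gamma)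
  then have eq: "(cmod (Gamma z))\<^sup>2 = pi / cosh (pi * y)"
    unfolding complex_norm_square[symmetric] using of_real_eq_iff by blast
  have "exp (pi * \<bar>y\<bar>) \<le> 2 * cosh (pi * y)"
    by (cases "y \<ge> 0") (simp_all add: cosh_def)
  then have "pi / cosh (pi * y) \<le> pi / (exp (pi * \<bar>y\<bar>) / 2)"
    by (intro divide_left_mono) (auto intro!: mult_pos_pos)
  also have "\<dots> = (sqrt (2 * pi) * exp (- (pi * \<bar>y\<bar> / 2)))\<^sup>2"
    by (simp add: power_mult_distrib exp_minus field_simps flip: exp_double)
  finally have "(cmod (Gamma z))\<^sup>2 \<le> (sqrt (2 * pi) * exp (- (pi * \<bar>y\<bar> / 2)))\<^sup>2"
    unfolding eq .
  then show ?thesis unfolding z_def by (rule power2_le_imp_le) simp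
qed

text \<open>Integrate the bound on the digamma function along the horizontal segment from the line
  \<open>Re z = 1/2\<close>, on which the reflection formula gives the modulus.\<close>
lemma cmod_Gamma_right_le:
  fixes z :: complex
  assumes "1/2 \<le> Re z" "Re z \<le> 1/2 + A"
  shows "cmod (Gamma z) \<le> sqrt (2 * pi) * (exp (5/2) * (A + 1)) powr A
           * (1 + \<bar>Im z\<bar>) powr (Re z - 1/2) * exp (- (pi * \<bar>Im z\<bar> / 2))"
proof -
  define y where "y = Im z"
  define a where "a = Re z - 1/2"
  define w where "w = Complex (1/2) y"
  have A: "A \<ge> 0" "a \<ge> 0" "a \<le> A" using assms by (auto simp: a_def)
  have zw: "z - w = of_real a" by (simp add: w_def a_def y_def complex_eq_iff)
  have seg: "Im u = y \<and> 1/2 \<le> Re u \<and> Re u \<le> 1/2 + A" if u: "u \<in> closed_segment w z" for u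
  proof -
    obtain t where t: "0 \<le> t" "t \<le> 1" "u = (1 - t) *\<^sub>R w + t *\<^sub>R z"
      using u by (auto simp: closed_segment_def)
    have "u = w + t *\<^sub>R (z - w)" unfolding t by (simp add: algebra_simps)
    then have u': "u = w + of_real (t * a)" unfolding zw by (simp add: scaleR_conv_of_real)
    have "t * a \<le> 1 * A" using t A by (intro mult_mono) auto
    then show ?thesis unfolding u' using t A by (simp add: w_def)
  qed
  have nonpos: "u \<notin> \<real>\<^sub>\<le>\<^sub>0" if "1/2 \<le> Re u" for u
    using that by (auto simp: complex_nonpos_Reals_iff)
  have nonposI: "u \<notin> \<int>\<^sub>\<le>\<^sub>0" if "1/2 \<le> Re u" for u
    using that by (auto elim!: nonpos_Ints_cases')
  \<comment> \<open>The integration takes the form of the mean value theorem for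
    \<open>ln_Gamma\<close>, whose real part is the logarithm of the modulus of Gamma.\<close>
  have "\<exists>u. u \<in> closed_segment w z \<and>
      Re (ln_Gamma z) - Re (ln_Gamma w) = Re (Digamma u * (z - w))"
    by (rule complex_mvt_line) (auto intro!: has_field_derivative_ln_Gamma_complex nonpos dest: seg)
  then obtain u where u: "u \<in> closed_segment w z"
    and diff: "Re (ln_Gamma z) - Re (ln_Gamma w) = Re (Digamma u * (z - w))" by blast
  have su: "Im u = y" "1/2 \<le> Re u" "Re u \<le> 1/2 + A" using seg[OF u] by auto
  have "cmod u \<le> \<bar>Re u\<bar> + \<bar>Im u\<bar>" by (rule cmod_le)
  also have "\<dots> \<le> (A + 1) * (1 + \<bar>y\<bar>)"
  proof -
    have "0 \<le> A * \<bar>y\<bar>" using A by simp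
    moreover have "(A + 1) * (1 + \<bar>y\<bar>) = A + 1 + A * \<bar>y\<bar> + \<bar>y\<bar>"
      by (simp add: algebra_simps)
    ultimately show ?thesis using su A by linarith
  qed
  finally have cu: "cmod u \<le> (A + 1) * (1 + \<bar>y\<bar>)" .
  have upos: "cmod u > 0" using su by auto
  define E where "E = exp (5/2) * (A + 1) * (1 + \<bar>y\<bar>)"
  have Epos: "E > 0" unfolding E_def using A by (intro mult_pos_pos) auto
  have "Re (Digamma u) \<le> ln (cmod u) + 5/2" by (rule Re_Digamma_le) (rule su)
  also have "\<dots> \<le> ln ((A + 1) * (1 + \<bar>y\<bar>)) + 5/2"
    using cu upos by (intro add_right_mono ln_mono) auto
  also have "\<dots> = ln E"
    unfolding E_def using A by (simp add: ln_mult add_pos_nonneg mult.assoc)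
  finally have "Re (Digamma u * (z - w)) \<le> ln E * a"
    unfolding zw using A by (simp add: mult_right_mono)
  then have le: "Re (ln_Gamma z) \<le> Re (ln_Gamma w) + a * ln E" using diff by (simp add: mult.commute)
  have "cmod (Gamma z) = exp (Re (ln_Gamma z))"
    using nonposI[OF assms(1)] by (simp add: Gamma_complex_altdef)
  also have "\<dots> \<le> exp (Re (ln_Gamma w)) * exp (a * ln E)"
    using le by (simp flip: exp_add)
  also have "exp (Re (ln_Gamma w)) = cmod (Gamma w)"
    using nonposI[of w] by (simp add: Gamma_complex_altdef w_def)
  also have "exp (a * ln E) = E powr a" using Epos by (simp add: powr_def)
  also have "E powr a = (exp (5/2) * (A + 1)) powr a * (1 + \<bar>y\<bar>) powr a"
    unfolding E_def using A by (intro powr_mult)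
  \<comment> \<open>The constant base is at least 1, so its exponent may grow from \<open>a\<close>
    to \<open>A\<close>; the power of \<open>1 + \<bar>y\<bar>\<close> keeps the exact exponent
    \<open>a\<close>.\<close>
  also have "cmod (Gamma w) * ((exp (5/2) * (A + 1)) powr a * (1 + \<bar>y\<bar>) powr a) \<le>
     (sqrt (2 * pi) * exp (- (pi * \<bar>y\<bar> / 2))) * ((exp (5/2) * (A + 1)) powr A * (1 + \<bar>y\<bar>) powr a)"
  proof (intro mult_mono powr_mono A)
    show "cmod (Gamma w) \<le> sqrt (2 * pi) * exp (- (pi * \<bar>y\<bar> / 2))"
      unfolding w_def by (rule cmod_Gamma_half_le)
    have "1 * 1 \<le> exp (5/2) * (A + 1)" using A by (intro mult_mono) auto
    then show "1 \<le> exp (5/2) * (A + 1)" by simp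
  qed auto
  finally show ?thesis by (simp add: a_def y_def mult_ac)
qed

section \<open>Extension of the Gamma bound to general vertical strips\<close>

lemma not_nonpos_Int_if_dist:
  fixes z :: complex
  assumes "d > 0" "\<And>k::nat. cmod (z + of_nat k) \<ge> d"
  shows "z \<notin> \<int>\<^sub>\<le>\<^sub>0"
proof
  assume "z \<in> \<int>\<^sub>\<le>\<^sub>0"
  then obtain k where "z = - of_nat k" by (elim nonpos_Ints_cases')
  with assms(2)[of k] assms(1) show False by simp
qed

text \<open>A shift by \<open>N \<ge> A\<close> moves \<open>z\<close> into the half-plane already
  treated. Returning means dividing by \<open>pochhammer z N\<close>, each of whose factors is at
  least a constant times \<open>1 + \<bar>Im z\<bar>\<close>; this restores the exponent
  \<open>Re z - 1/2\<close>.\<close>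

lemma Gamma_vertical_bound:
  assumes "A \<ge> 0" "d > 0"
  obtains C where "C > 0"
    "\<And>z. \<lbrakk>\<bar>Re z - 1/2\<bar> \<le> A; \<And>k::nat. cmod (z + of_nat k) \<ge> d\<rbrakk> \<Longrightarrow>
       cmod (Gamma z) \<le> C * (1 + \<bar>Im z\<bar>) powr (Re z - 1/2) * exp (- (pi * \<bar>Im z\<bar> / 2))"
proof -
  define N where "N = nat \<lceil>A\<rceil>"
  define B where "B = A + real N"
  \<comment> \<open>A Pochhammer factor has modulus \<open>v\<close> at least \<open>d\<close> and
    at least \<open>\<bar>Im z\<bar>\<close>; together these give
    \<open>d * (1 + \<bar>Im z\<bar>) \<le> (1 + d) * v\<close>.\<close>
  define c where "c = d / (1 + d)"
  define K where "K = sqrt (2 * pi) * (exp (5/2) * (B + 1)) powr B"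
  have B: "B \<ge> 0" using assms by (simp add: B_def)
  have c: "c > 0" using assms by (simp add: c_def)
  have N: "real N \<ge> A" unfolding N_def using assms by linarith
  have K: "K > 0" unfolding K_def using B by simp
  have "cmod (Gamma z) \<le> K / c ^ N * (1 + \<bar>Im z\<bar>) powr (Re z - 1/2) * exp (- (pi * \<bar>Im z\<bar> / 2))"
    if z: "\<bar>Re z - 1/2\<bar> \<le> A" and zd: "\<And>k::nat. cmod (z + of_nat k) \<ge> d" for z
  proof -
    define Y where "Y = 1 + \<bar>Im z\<bar>"
    have Y: "Y > 0" by (simp add: Y_def add_pos_nonneg)
    have nz: "z \<notin> \<int>\<^sub>\<le>\<^sub>0" using not_nonpos_Int_if_dist[OF assms(2) zd] .
    have low: "c * Y \<le> cmod (z + of_nat k)" for k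
    proof -
      have "d * \<bar>Im z\<bar> \<le> d * cmod (z + of_nat k)"
        using abs_Im_le_cmod[of "z + of_nat k"] assms by (intro mult_left_mono) auto
      with zd[of k] have "d * Y \<le> cmod (z + of_nat k) * (1 + d)"
        by (simp add: Y_def algebra_simps)
      then show ?thesis using assms by (simp add: c_def field_simps)
    qed
    have "(c * Y) ^ N = (\<Prod>k<N. c * Y)" by simp
    also have "\<dots> \<le> (\<Prod>k<N. cmod (z + of_nat k))"
      using c Y low by (intro prod_mono) auto
    also have "\<dots> = cmod (pochhammer z N)"
      by (simp add: pochhammer_prod prod_norm atLeast0LessThan)
    finally have poch: "(c * Y) ^ N \<le> cmod (pochhammer z N)" .
    have "cmod (pochhammer z N) * cmod (Gamma z) = cmod (Gamma (z + of_nat N))"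
      using pochhammer_Gamma[OF nz, of N] nz by (simp add: Gamma_eq_zero_iff norm_divide)
    then have "(c * Y) ^ N * cmod (Gamma z) \<le> cmod (Gamma (z + of_nat N))"
      using mult_right_mono[OF poch, of "cmod (Gamma z)"] by simp
    also have "\<dots> \<le> K * Y powr (Re z - 1/2 + real N) * exp (- (pi * \<bar>Im z\<bar> / 2))"
      using cmod_Gamma_right_le[of "z + of_nat N" B] z N
      by (simp add: B_def K_def Y_def algebra_simps abs_le_iff)
    also have "\<dots> = Y ^ N * (K * Y powr (Re z - 1/2) * exp (- (pi * \<bar>Im z\<bar> / 2)))"
      using Y by (simp add: powr_add powr_realpow)
    finally have "Y ^ N * (c ^ N * cmod (Gamma z)) \<le> Y ^ N * (K * Y powr (Re z - 1/2) * exp (- (pi * \<bar>Im z\<bar> / 2)))"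
      by (simp add: power_mult_distrib mult_ac)
    then have "c ^ N * cmod (Gamma z) \<le> K * Y powr (Re z - 1/2) * exp (- (pi * \<bar>Im z\<bar> / 2))"
      using Y by simp
    then show ?thesis using c by (simp add: Y_def field_simps)
  qed
  then show thesis using K c by (intro that[of "K / c ^ N"]) auto
qed

text \<open>For the denominator of the Beta function, whose argument always has real part 1.
  Reflection at \<open>z = \<i> * y\<close> gives the squared modulus times
  \<open>\<bar>y\<bar>\<close>, whence the power \<open>-1/2\<close>; near \<open>y = 0\<close>,
  where that factor vanishes, compactness is used.\<close>

lemma rGamma_vertical_bound:
  obtains C where "C > 0"
    "\<And>y. cmod (rGamma (Complex 1 y)) \<le> C * (1 + \<bar>y\<bar>) powr (-1/2) * exp (pi * \<bar>y\<bar> / 2)"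
proof -
  have "compact ((\<lambda>y. rGamma (Complex 1 y)) ` {-1..1})"
    unfolding Complex_eq
    by (intro compact_continuous_image
        continuous_on_compose2[OF holomorphic_on_imp_continuous_on[OF holomorphic_rGamma[of UNIV]]]
        continuous_intros) auto
  then obtain K where K: "K > 0" "\<And>y. y \<in> {-1..1} \<Longrightarrow> cmod (rGamma (Complex 1 y)) \<le> K"
    by (auto simp: bounded_pos dest!: compact_imp_bounded)
  \<comment> \<open>The factor \<open>sqrt 2\<close> pays for
    \<open>1 + \<bar>y\<bar> \<le> 2\<close> on the compact range; beyond it the constant 1
    suffices.\<close>
  define C where "C = max 1 (sqrt 2 * K)"
  have C: "C \<ge> 1" "C \<ge> sqrt 2 * K" by (auto simp: C_def)
  have sq: "(1 + \<bar>y\<bar>) * (cmod (rGamma (Complex 1 y)))\<^sup>2 \<le> C\<^sup>2 * exp (pi * \<bar>y\<bar>)" for y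
  proof (cases "\<bar>y\<bar> \<le> 1")
    case True
    have "(1 + \<bar>y\<bar>) * (cmod (rGamma (Complex 1 y)))\<^sup>2 \<le> 2 * K\<^sup>2"
      using True K(1) K(2)[of y] by (intro mult_mono power_mono) (auto simp: abs_le_iff)
    also have "\<dots> = (sqrt 2 * K)\<^sup>2" by (simp add: power_mult_distrib)
    also have "\<dots> \<le> C\<^sup>2" using K C by (intro power_mono) auto
    also have "\<dots> \<le> C\<^sup>2 * exp (pi * \<bar>y\<bar>)"
      using C by (simp add: mult_le_cancel_left1)
    finally show ?thesis .
  next
    case False
    define z where "z = \<i> * complex_of_real y"
    have z: "z + 1 = Complex 1 y" "1 - z = cnj (Complex 1 y)"
      by (auto simp: z_def complex_eq_iff)
    have "cmod (rGamma z * rGamma (1 - z)) = \<bar>y\<bar> * (cmod (rGamma (Complex 1 y)))\<^sup>2"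
      unfolding rGamma_plus1[of z, symmetric] z
      by (simp add: z_def norm_mult power2_eq_square flip: cnj_rGamma)
    moreover have "cmod (rGamma z * rGamma (1 - z)) = cmod (sin (of_real pi * z)) / pi"
      unfolding rGamma_reflection_complex by (simp add: norm_divide)
    moreover have "cmod (sin (of_real pi * z)) \<le> exp (pi * \<bar>y\<bar>)"
    proof -
      have "cmod (sin (of_real pi * z)) \<le> (cmod (exp (\<i> * (of_real pi * z))) + cmod (exp (- (\<i> * (of_real pi * z))))) / 2"
        using norm_triangle_ineq4[of "exp (\<i> * (of_real pi * z))" "exp (- (\<i> * (of_real pi * z)))"]
        unfolding sin_exp_eq by (simp add: norm_divide norm_mult del: norm_exp_eq_Re)
      also have "\<dots> = (exp (- (pi * y)) + exp (pi * y)) / 2"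
        by (simp add: z_def)
      also have "\<dots> \<le> exp (pi * \<bar>y\<bar>)"
      proof -
        have "pi * (- y) \<le> pi * \<bar>y\<bar>" "pi * y \<le> pi * \<bar>y\<bar>"
          by (intro mult_left_mono; simp)+
        then have "exp (- (pi * y)) \<le> exp (pi * \<bar>y\<bar>)" "exp (pi * y) \<le> exp (pi * \<bar>y\<bar>)"
          by simp_all
        moreover have "(a + b) / 2 \<le> e" if "a \<le> e" "b \<le> e" for a b e :: real
          using that by simp
        ultimately show ?thesis by blast
      qed
      finally show ?thesis .
    qed
    ultimately have "\<bar>y\<bar> * (cmod (rGamma (Complex 1 y)))\<^sup>2 \<le> exp (pi * \<bar>y\<bar>) / pi"
      using divide_right_mono pi_ge_zero by metis
    \<comment> \<open>Trading \<open>pi\<close> for 2 leaves the factor needed for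
      \<open>1 + \<bar>y\<bar> \<le> 2 * \<bar>y\<bar>\<close>.\<close>
    also have "\<dots> \<le> exp (pi * \<bar>y\<bar>) / 2"
      using pi_ge_two by (intro divide_left_mono) auto
    finally have "2 * \<bar>y\<bar> * (cmod (rGamma (Complex 1 y)))\<^sup>2 \<le> exp (pi * \<bar>y\<bar>)" by simp
    moreover have "(1 + \<bar>y\<bar>) * (cmod (rGamma (Complex 1 y)))\<^sup>2 \<le> 2 * \<bar>y\<bar> * (cmod (rGamma (Complex 1 y)))\<^sup>2"
      using False by (intro mult_right_mono) auto
    moreover have "exp (pi * \<bar>y\<bar>) \<le> C\<^sup>2 * exp (pi * \<bar>y\<bar>)"
      using C by simp
    ultimately show ?thesis by linarith
  qed
  have "cmod (rGamma (Complex 1 y)) \<le> C * (1 + \<bar>y\<bar>) powr (-1/2) * exp (pi * \<bar>y\<bar> / 2)" for y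
  proof (rule power2_le_imp_le)
    have Y: "1 + \<bar>y\<bar> > 0" by simp
    have p: "((1 + \<bar>y\<bar>) powr (-1/2))\<^sup>2 = inverse (1 + \<bar>y\<bar>)"
      using Y by (simp add: power2_eq_square powr_minus_divide inverse_eq_divide flip: powr_add)
    have e: "(exp (pi * \<bar>y\<bar> / 2))\<^sup>2 = exp (pi * \<bar>y\<bar>)"
      by (simp flip: exp_double)
    show "(cmod (rGamma (Complex 1 y)))\<^sup>2 \<le> (C * (1 + \<bar>y\<bar>) powr (-1/2) * exp (pi * \<bar>y\<bar> / 2))\<^sup>2"
      unfolding power_mult_distrib p e using sq[of y] Y by (simp add: field_simps)
  qed (use C in auto)
  then show thesis using C by (intro that[of C]) auto
qed

section \<open>Trace norm and entrywise sums\<close>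

text \<open>The empty family, \<open>N = 0\<close>, takes part in the supremum and contributes
  0.\<close>

lemma trace_norm_nonneg: "0 \<le> trace_norm M"
proof -
  have "ereal (\<Sum>k<(0::nat). cmod (mform M (undefined k) (undefined k))) \<le> trace_norm M"
    unfolding trace_norm_def
    by (rule SUP_upper2[where i = "(0, undefined, undefined)"]) (auto simp: orthonormal_fam_def)
  then show ?thesis by (simp add: zero_ereal_def)
qed

lemma ip_eq_sum:
  assumes "finite S" "supp u \<inter> supp v \<subseteq> S"
  shows "ip u v = (\<Sum>n\<in>S. cnj (u n) * v n)"
  unfolding ip_def using assms by (intro sum.mono_neutral_left) (auto simp: supp_def)

text \<open>Bessel's inequality for the standard basis vector at \<open>m\<close>, from the nonnegativity of the
  squared distance to its projection onto the span of the family.\<close>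
lemma orthonormal_fam_column_le:
  assumes "orthonormal_fam N e"
  shows "(\<Sum>k<N. (cmod (e k m))\<^sup>2) \<le> 1"
proof -
  define S where "S = insert m (\<Union>k<N. supp (e k))"
  \<comment> \<open>\<open>v\<close> is the projection of the basis vector \<open>b\<close> at
    \<open>m\<close>: its coefficient along \<open>e k\<close> is
    \<open>ip (e k) b = cnj (e k m)\<close>.\<close>
  define v where "v n = (\<Sum>k<N. cnj (e k m) * e k n)" for n
  define b where "b n = (if n = m then 1 else 0 :: complex)" for n
  define c where "c = (\<Sum>k<N. (cmod (e k m))\<^sup>2)"
  have S: "finite S" "m \<in> S" using assms by (auto simp: S_def orthonormal_fam_def)
  have ip: "(\<Sum>n\<in>S. cnj (e j n) * e k n) = (if j = k then 1 else 0)" if "j < N" "k < N" for j k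
    using ip_eq_sum[OF S(1), of "e j" "e k"] assms that
    by (fastforce simp: orthonormal_fam_def S_def)
  have vm: "v m = of_real c"
    by (simp add: v_def c_def complex_norm_square mult.commute del: of_real_power)
  have "(\<Sum>n\<in>S. cnj (v n) * v n) =
      (\<Sum>n\<in>S. \<Sum>j<N. \<Sum>k<N. e j m * cnj (e k m) * (cnj (e j n) * e k n))"
    unfolding v_def cnj_sum sum_product by (intro sum.cong refl) simp
  also have "\<dots> = (\<Sum>j<N. \<Sum>k<N. e j m * cnj (e k m) * (\<Sum>n\<in>S. cnj (e j n) * e k n))"
    by (simp add: sum_distrib_left sum.swap[of _ S])
  also have "\<dots> = (\<Sum>j<N. \<Sum>k<N. if j = k then e j m * cnj (e k m) else 0)"
    by (intro sum.cong refl) (auto simp: ip)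
  also have "\<dots> = (\<Sum>j<N. e j m * cnj (e j m))" by simp
  also have "\<dots> = of_real c"
    by (simp add: c_def complex_norm_square del: of_real_power)
  finally have vv: "(\<Sum>n\<in>S. cnj (v n) * v n) = of_real c" .
  have "complex_of_real (\<Sum>n\<in>S. (cmod (b n - v n))\<^sup>2) =
      (\<Sum>n\<in>S. cnj (b n - v n) * (b n - v n))"
    by (simp add: complex_norm_square mult.commute del: of_real_power)
  also have "\<dots> = (\<Sum>n\<in>S. (if n = m then 1 - cnj (v n) - v n else 0) + cnj (v n) * v n)"
    by (intro sum.cong refl) (auto simp: b_def algebra_simps)
  also have "\<dots> = 1 - cnj (v m) - v m + of_real c"
    using S by (simp add: sum.distrib vv)
  also have "\<dots> = of_real (1 - c)" by (simp add: vm)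
  finally have "(\<Sum>n\<in>S. (cmod (b n - v n))\<^sup>2) = 1 - c"
    by (simp only: of_real_eq_iff)
  moreover have "0 \<le> (\<Sum>n\<in>S. (cmod (b n - v n))\<^sup>2)" by (intro sum_nonneg) auto
  ultimately show ?thesis by (simp add: c_def)
qed

text \<open>After expansion of the forms, the entry at \<open>(n, m)\<close> carries the weight
  \<open>\<Sum>k<N. cmod (f k n) * cmod (e k m)\<close>, which is at most 1 by the
  arithmetic-geometric mean inequality and Bessel's inequality for both families.\<close>

lemma trace_norm_le_entrywise:
  assumes "\<And>F. finite F \<Longrightarrow> (\<Sum>(n,m)\<in>F. cmod (M n m)) \<le> K"
  shows "trace_norm M \<le> ereal K"
  unfolding trace_norm_def
proof (rule SUP_least, clarify)
  fix N e f
  assume e: "orthonormal_fam N e" and f: "orthonormal_fam N f"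
  define S where "S = (\<Union>k<N. supp (e k)) \<union> (\<Union>k<N. supp (f k))"
  have S: "finite S" using e f by (auto simp: S_def orthonormal_fam_def)
  have form: "cmod (mform M (e k) (f k)) \<le> (\<Sum>n\<in>S. \<Sum>m\<in>S. cmod (M n m) * (cmod (f k n) * cmod (e k m)))"
    if "k < N" for k
  proof -
    have sub: "supp (e k) \<subseteq> S" "supp (f k) \<subseteq> S" using that by (auto simp: S_def)
    have "cmod (mform M (e k) (f k)) \<le> (\<Sum>n\<in>supp (f k). \<Sum>m\<in>supp (e k). cmod (cnj (f k n) * M n m * e k m))"
      unfolding mform_def by (intro order.trans[OF norm_sum] sum_mono norm_sum)
    also have "\<dots> \<le> (\<Sum>n\<in>S. \<Sum>m\<in>S. cmod (cnj (f k n) * M n m * e k m))"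
      using sub S by (intro order.trans[OF sum_mono sum_mono2] sum_mono2 sum_nonneg) auto
    finally show ?thesis by (simp add: norm_mult mult_ac)
  qed
  have cs: "(\<Sum>k<N. cmod (f k n) * cmod (e k m)) \<le> 1" for n m
  proof -
    have "(\<Sum>k<N. cmod (f k n) * cmod (e k m)) \<le> (\<Sum>k<N. ((cmod (f k n))\<^sup>2 + (cmod (e k m))\<^sup>2) / 2)"
    proof (rule sum_mono)
      fix k
      show "cmod (f k n) * cmod (e k m) \<le> ((cmod (f k n))\<^sup>2 + (cmod (e k m))\<^sup>2) / 2"
        using sum_squares_bound[of "cmod (f k n)" "cmod (e k m)"] by simp
    qed
    also have "\<dots> = ((\<Sum>k<N. (cmod (f k n))\<^sup>2) + (\<Sum>k<N. (cmod (e k m))\<^sup>2)) / 2"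
      by (simp add: sum.distrib flip: sum_divide_distrib)
    also have "\<dots> \<le> 1"
      using orthonormal_fam_column_le[OF e, of m] orthonormal_fam_column_le[OF f, of n] by simp
    finally show ?thesis .
  qed
  have "(\<Sum>k<N. cmod (mform M (e k) (f k))) \<le>
      (\<Sum>k<N. \<Sum>n\<in>S. \<Sum>m\<in>S. cmod (M n m) * (cmod (f k n) * cmod (e k m)))"
    by (intro sum_mono form) auto
  also have "\<dots> = (\<Sum>n\<in>S. \<Sum>m\<in>S. cmod (M n m) * (\<Sum>k<N. cmod (f k n) * cmod (e k m)))"
    by (simp add: sum_distrib_left sum.swap[of _ _ "{..<N}"])
  also have "\<dots> \<le> (\<Sum>n\<in>S. \<Sum>m\<in>S. cmod (M n m) * 1)"
    by (intro sum_mono mult_left_mono cs) auto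
  also have "\<dots> = (\<Sum>(n,m)\<in>S\<times>S. cmod (M n m))"
    by (simp add: sum.cartesian_product)
  also have "\<dots> \<le> K" using S by (intro assms) auto
  finally show "ereal (\<Sum>k<N. cmod (mform M (e k) (f k))) \<le> ereal K" by simp
qed

text \<open>Second-order Taylor estimate, with the second derivative bounded by Cauchy's inequality.\<close>
lemma holomorphic_difference_quotient_bound:
  assumes hol: "h holomorphic_on ball s r" and r: "r > 0"
    and bd: "\<And>z. z \<in> ball s r \<Longrightarrow> cmod (h z) \<le> B"
    and z: "z \<in> ball s (r/2)" "z \<noteq> s"
  shows "cmod ((h z - h s) / (z - s) - deriv h s) \<le> 32 * B / r\<^sup>2 * cmod (z - s)"
proof -
  have sub: "ball s (r/2) \<subseteq> ball s r" using r by (intro subset_ball) auto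
  have "cmod ((deriv ^^ 0) h z - (\<Sum>i\<le>1. (deriv ^^ i) h s * (z - s) ^ i / fact i))
      \<le> 32 * B / r\<^sup>2 * cmod (z - s) ^ Suc 1 / fact 1"
  proof (rule complex_Taylor[where S = "ball s (r/2)"])
    fix i x assume x: "x \<in> ball s (r/2)"
    show "((deriv ^^ i) h has_field_derivative (deriv ^^ Suc i) h x) (at x within ball s (r/2))"
      using holomorphic_derivI[OF holomorphic_higher_deriv[OF hol open_ball] open_ball, of x i] x sub
      by (auto intro: has_field_derivative_at_within)
  next
    fix x assume x: "x \<in> ball s (r/2)"
    have sub': "cball x (r/4) \<subseteq> ball s r"
    proof
      fix w assume "w \<in> cball x (r/4)"
      then show "w \<in> ball s r" using x r dist_triangle[of s w x] by auto
    qed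
    \<comment> \<open>The disc of radius \<open>r/4\<close> about \<open>x\<close> stays inside
      \<open>ball s r\<close>, and \<open>2 * B / (r/4)^2\<close> is the source of the constant
      32.\<close>
    have "cmod ((deriv ^^ 2) h x) \<le> fact 2 * B / (r/4) ^ 2"
    proof (rule Cauchy_inequality)
      show "h holomorphic_on ball x (r/4)"
        using hol sub' ball_subset_cball by (blast intro: holomorphic_on_subset)
      show "continuous_on (cball x (r/4)) h"
        using hol sub' by (blast intro: holomorphic_on_imp_continuous_on holomorphic_on_subset)
      show "cmod (h w) \<le> B" if "cmod (x - w) = r/4" for w
        using that sub' by (intro bd) (auto simp: dist_norm)
    qed (use r in auto)
    then show "cmod ((deriv ^^ Suc 1) h x) \<le> 32 * B / r\<^sup>2"
      by (simp add: numeral_2_eq_2 power2_eq_square field_simps)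
  qed (use z r in auto)
  then have "cmod (h z - h s - deriv h s * (z - s)) \<le> 32 * B / r\<^sup>2 * cmod (z - s) * cmod (z - s)"
    by (simp add: algebra_simps power2_eq_square)
  moreover have "h z - h s - deriv h s * (z - s) = ((h z - h s) / (z - s) - deriv h s) * (z - s)"
    using z by (simp add: field_simps)
  ultimately have "cmod ((h z - h s) / (z - s) - deriv h s) * cmod (z - s)
      \<le> 32 * B / r\<^sup>2 * cmod (z - s) * cmod (z - s)"
    by (simp add: norm_mult)
  then show ?thesis using z by (subst (asm) mult_le_cancel_right_pos) auto
qed

text \<open>The derivative is taken entry by entry. The Taylor remainder at \<open>(n, m)\<close> is
  at most a constant times \<open>B n m * cmod (z - s)\<close>, so the bound on the sums of
  \<open>B\<close> makes the trace norm of the whole remainder tend to 0.\<close>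

lemma trace_class_analytic_onI:
  assumes "\<And>s. s \<in> U \<Longrightarrow> \<exists>r>0. \<exists>B K. (\<forall>n m. (\<lambda>z. H z n m) holomorphic_on ball s r) \<and>
     (\<forall>n m. \<forall>z\<in>ball s r. cmod (H z n m) \<le> B n m) \<and>
     (\<forall>F. finite F \<longrightarrow> (\<Sum>(n,m)\<in>F. B n m) \<le> K)"
  shows "trace_class_analytic_on H U"
  unfolding trace_class_analytic_on_def
proof (intro ballI conjI exI)
  fix s assume "s \<in> U"
  then obtain r B K where r: "r > 0" and hol: "\<And>n m. (\<lambda>z. H z n m) holomorphic_on ball s r"
    and bd: "\<And>n m z. z \<in> ball s r \<Longrightarrow> cmod (H z n m) \<le> B n m"
    and K: "\<And>F. finite F \<Longrightarrow> (\<Sum>(n,m)\<in>F. B n m) \<le> K"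
    using assms by metis
  have "trace_norm (H s) \<le> ereal K"
  proof (rule trace_norm_le_entrywise)
    fix F :: "(int \<times> int) set" assume F: "finite F"
    have "(\<Sum>(n,m)\<in>F. cmod (H s n m)) \<le> (\<Sum>(n,m)\<in>F. B n m)"
      using r by (intro sum_mono) (auto intro!: bd)
    with K[OF F] show "(\<Sum>(n,m)\<in>F. cmod (H s n m)) \<le> K" by simp
  qed
  then show "trace_class (H s)" unfolding trace_class_def by auto
  let ?D = "\<lambda>n m. deriv (\<lambda>z. H z n m) s"
  have bound: "trace_norm (\<lambda>n m. (H z n m - H s n m) / (z - s) - ?D n m)
      \<le> ereal (32 * K / r\<^sup>2 * cmod (z - s))" if z: "z \<in> ball s (r/2)" "z \<noteq> s" for z
  proof (rule trace_norm_le_entrywise)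
    fix F :: "(int \<times> int) set" assume F: "finite F"
    have "(\<Sum>(n,m)\<in>F. cmod ((H z n m - H s n m) / (z - s) - ?D n m))
        \<le> (\<Sum>(n,m)\<in>F. 32 * B n m / r\<^sup>2 * cmod (z - s))"
      using holomorphic_difference_quotient_bound[OF hol r bd z] by (intro sum_mono) auto
    also have "\<dots> = 32 / r\<^sup>2 * cmod (z - s) * (\<Sum>(n,m)\<in>F. B n m)"
      by (simp add: sum_distrib_left case_prod_beta mult_ac sum_divide_distrib)
    also have "\<dots> \<le> 32 / r\<^sup>2 * cmod (z - s) * K"
      using K[OF F] by (intro mult_left_mono) auto
    finally show "(\<Sum>(n,m)\<in>F. cmod ((H z n m - H s n m) / (z - s) - ?D n m))
        \<le> 32 * K / r\<^sup>2 * cmod (z - s)" by (simp add: mult_ac)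
  qed
  show "((\<lambda>z. trace_norm (\<lambda>n m. (H z n m - H s n m) / (z - s) - ?D n m)) \<longlongrightarrow> 0) (at s)"
  proof (rule tendsto_sandwich)
    show "\<forall>\<^sub>F z in at s. 0 \<le> trace_norm (\<lambda>n m. (H z n m - H s n m) / (z - s) - ?D n m)"
      by (simp add: trace_norm_nonneg)
    show "\<forall>\<^sub>F z in at s. trace_norm (\<lambda>n m. (H z n m - H s n m) / (z - s) - ?D n m)
        \<le> ereal (32 * K / r\<^sup>2 * cmod (z - s))"
      unfolding eventually_at using r bound
      by (intro exI[of _ "r/2"]) (auto simp: dist_commute)
    have "((\<lambda>z. 32 * K / r\<^sup>2 * cmod (z - s)) \<longlongrightarrow> 32 * K / r\<^sup>2 * cmod (s - s)) (at s)"
      by (intro tendsto_intros)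
    then show "((\<lambda>z. ereal (32 * K / r\<^sup>2 * cmod (z - s))) \<longlongrightarrow> 0) (at s)"
      by (simp add: zero_ereal_def)
  qed auto
qed

section \<open>Summation along diagonals\<close>

text \<open>Comparison with the integral of \<open>x powr (-t)\<close>, in discrete form: the
  induction step is the tangent inequality for the concave function
  \<open>x powr (1 - t)\<close>.\<close>

lemma powr_partial_sum_le:
  fixes t :: real
  assumes "0 < t" "t < 1"
  shows "(\<Sum>k\<le>L. (1 + real k) powr (-t)) \<le> (1 + real L) powr (1 - t) / (1 - t)"
proof (induction L)
  case 0
  show ?case using assms by (simp add: field_simps)
next
  case (Suc L)
  define x where "x = 2 + real L"
  have x: "x > 1" by (simp add: x_def)
  \<comment> \<open>Young's inequality with weights \<open>1 - t\<close> and \<open>t\<close>, the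
    second argument being 1, is Bernoulli's inequality for the exponent
    \<open>1 - t\<close>.\<close>
  have "((x - 1) / x) powr (1 - t) * 1 powr t \<le> (1 - t) * ((x - 1) / x) + t * 1"
    using assms x by (intro Youngs_inequality_0) auto
  also have "\<dots> = 1 - (1 - t) / x" using x by (simp add: field_simps)
  finally have "(x - 1) powr (1 - t) / x powr (1 - t) \<le> 1 - (1 - t) / x"
    using x by (simp add: powr_divide)
  then have "(x - 1) powr (1 - t) \<le> x powr (1 - t) - (1 - t) * (x powr (1 - t) / x)"
    using x by (simp add: field_simps)
  also have "x powr (1 - t) / x = x powr (-t)"
    using x by (simp add: powr_diff powr_minus field_simps)
  finally have "((x - 1) powr (1 - t) + (1 - t) * x powr (-t)) / (1 - t) \<le> x powr (1 - t) / (1 - t)"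
    using assms by (intro divide_right_mono) auto
  then have "(x - 1) powr (1 - t) / (1 - t) + x powr (-t) \<le> x powr (1 - t) / (1 - t)"
    using assms by (simp add: add_divide_distrib)
  then show ?case using Suc.IH by (simp add: x_def add_ac)
qed

text \<open>The borderline exponent, from which the logarithm in \<open>rho\<close> arises.\<close>

lemma harmonic_partial_sum_le:
  "(\<Sum>k\<le>L. (1 + real k) powr (-1)) \<le> 1 + ln (1 + real L)"
proof (induction L)
  case 0
  show ?case by simp
next
  case (Suc L)
  define x where "x = 2 + real L"
  have x: "x > 1" by (simp add: x_def)
  have "ln ((x - 1) / x) \<le> (x - 1) / x - 1" using x by (intro ln_le_minus_one) auto
  then have "ln (x - 1) - ln x \<le> - (1 / x)"
    using x by (simp add: ln_div field_simps)
  then have "ln (x - 1) + x powr (-1) \<le> ln x" using x by (simp add: powr_minus_divide)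
  then show ?case using Suc.IH by (simp add: x_def add_ac)
qed

lemma powr_partial_sum_bounded:
  fixes t :: real
  assumes "t > 1"
  obtains S where "\<And>L. (\<Sum>k\<le>L. (1 + real k) powr (-t)) \<le> S"
proof
  have "summable (\<lambda>n. real n powr (-t))" using assms by (simp add: summable_real_powr_iff)
  then have "summable (\<lambda>n. real (Suc n) powr (-t))" by (subst summable_Suc_iff)
  then show "(\<Sum>k\<le>L. (1 + real k) powr (-t)) \<le> (\<Sum>n. real (Suc n) powr (-t))" for L
    using sum_le_suminf[of "\<lambda>n. real (Suc n) powr (-t)" "{..L}"] by simp
qed

section \<open>Comparison of the power sums with the weight \<open>rho\<close>\<close>

lemma jbr_ge: "(1 + \<bar>real_of_int l\<bar>) / 2 \<le> jbr l"
  unfolding jbr_def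
proof (rule real_le_rsqrt)
  have "2 * (1 * \<bar>real_of_int l\<bar>) \<le> 1 + \<bar>real_of_int l\<bar>\<^sup>2"
    using sum_squares_bound[of 1 "\<bar>real_of_int l\<bar>"] by simp
  moreover have "0 \<le> (real_of_int l)\<^sup>2" by simp
  ultimately show "((1 + \<bar>real_of_int l\<bar>) / 2)\<^sup>2 \<le> 1 + (real_of_int l)\<^sup>2"
    by (simp add: power2_eq_square field_simps)
qed

lemma jbr_pos: "jbr l > 0"
  by (simp add: jbr_def add_pos_nonneg)

lemma rho_nonneg: "0 \<le> rho t l"
  using jbr_pos[of l] by (auto simp: rho_def)

text \<open>The three cases of \<open>rho\<close> are the three regimes of the power sum: growth
  like \<open>\<bar>l\<bar> powr (1 - t)\<close>, which leaves the exponent \<open>1/2\<close>;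
  logarithmic growth; and boundedness.\<close>

lemma weighted_partial_sum_le_rho:
  assumes "t > 0"
  obtains C where "C > 0"
    "\<And>l. (1 + \<bar>real_of_int l\<bar>) powr (t - 1/2) * (\<Sum>k\<le>nat \<bar>l\<bar>. (1 + real k) powr (-t)) \<le> C * rho t l"
proof -
  have half: "(1 + \<bar>real_of_int l\<bar>) powr (1/2) \<le> 2 * sqrt (jbr l)" for l
  proof -
    have "(1 + \<bar>real_of_int l\<bar>) powr (1/2) = sqrt (1 + \<bar>real_of_int l\<bar>)"
      by (simp add: powr_half_sqrt)
    also have "\<dots> \<le> sqrt (4 * jbr l)" 
      using jbr_ge[of l] jbr_pos[of l] by (intro real_sqrt_le_mono) (simp add: field_simps)
    also have "\<dots> = 2 * sqrt (jbr l)" by (simp add: real_sqrt_mult)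
    finally show ?thesis .
  qed
  consider "t < 1" | "t = 1" | "t > 1" by linarith
  then show thesis
  proof cases
    case 1
    show thesis
    proof (rule that[of "2 / (1 - t)"])
      fix l
      have "(1 + \<bar>real_of_int l\<bar>) powr (t - 1/2) * (\<Sum>k\<le>nat \<bar>l\<bar>. (1 + real k) powr (-t))
        \<le> (1 + \<bar>real_of_int l\<bar>) powr (t - 1/2) * ((1 + real (nat \<bar>l\<bar>)) powr (1 - t) / (1 - t))"
        using assms 1 by (intro mult_left_mono powr_partial_sum_le) auto
      also have "\<dots> = (1 + \<bar>real_of_int l\<bar>) powr (1/2) / (1 - t)"
        by (simp flip: powr_add)
      also have "\<dots> \<le> 2 * sqrt (jbr l) / (1 - t)"
        using 1 half[of l] by (intro divide_right_mono) auto
      finally show "(1 + \<bar>real_of_int l\<bar>) powr (t - 1/2) * (\<Sum>k\<le>nat \<bar>l\<bar>. (1 + real k) powr (-t))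
          \<le> 2 / (1 - t) * rho t l"
        using assms 1 by (simp add: rho_def)
    qed (use 1 in auto)
  next
    case 2
    show thesis
    \<comment> \<open>A factor 2 comes from passing to \<open>jbr\<close>, a factor 3 from absorbing
      \<open>1 + ln (1 + x)\<close> into \<open>ln (2 + x\<^sup>2)\<close>, which is at least
      \<open>ln 2\<close> even at \<open>l = 0\<close>.\<close>
    proof (rule that[of 6])
      fix l
      define x where "x = \<bar>real_of_int l\<bar>"
      have x: "x \<ge> 0" by (simp add: x_def)
      have "ln 2 \<le> ln (2 + x\<^sup>2)" by (intro ln_mono) auto
      then have "1 \<le> 2 * ln (2 + x\<^sup>2)" using ln2_ge_two_thirds by linarith
      moreover have "ln (1 + x) \<le> ln (2 + x\<^sup>2)"
      proof (rule ln_mono)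
        have "2 * x \<le> x\<^sup>2 + 1" using sum_squares_bound[of x 1] by simp
        then show "1 + x \<le> 2 + x\<^sup>2" using x by (cases "x \<le> 1") (auto simp: power2_eq_square intro: order.trans[of _ 2])
      qed (use x in auto)
      ultimately have log: "1 + ln (1 + x) \<le> 3 * ln (2 + x\<^sup>2)" by linarith
      have "(1 + \<bar>real_of_int l\<bar>) powr (t - 1/2) * (\<Sum>k\<le>nat \<bar>l\<bar>. (1 + real k) powr (-t))
        \<le> (1 + x) powr (1/2) * (1 + ln (1 + x))"
        using mult_left_mono[OF harmonic_partial_sum_le[of "nat \<bar>l\<bar>"], of "(1 + x) powr (1/2)"] 2
        by (simp add: x_def)
      also have "\<dots> \<le> (2 * sqrt (jbr l)) * (3 * ln (2 + x\<^sup>2))"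
        using half[of l] log x jbr_pos[of l] by (intro mult_mono) (auto simp: x_def)
      finally show "(1 + \<bar>real_of_int l\<bar>) powr (t - 1/2) * (\<Sum>k\<le>nat \<bar>l\<bar>. (1 + real k) powr (-t))
          \<le> 6 * rho t l"
        using 2 by (simp add: rho_def x_def)
    qed auto
  next
    case 3
    obtain S where S: "\<And>L. (\<Sum>k\<le>L. (1 + real k) powr (-t)) \<le> S"
      using powr_partial_sum_bounded[OF 3] by blast
    have Spos: "S > 0" using S[of 0] by simp
    show thesis
    proof (rule that[of "2 powr (t - 1/2) * S"])
      fix l
      have "(1 + \<bar>real_of_int l\<bar>) powr (t - 1/2) \<le> (2 * jbr l) powr (t - 1/2)"
        using 3 jbr_ge[of l] by (intro powr_mono2) auto
      also have "\<dots> = 2 powr (t - 1/2) * jbr l powr (t - 1/2)"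
        using jbr_pos[of l] by (intro powr_mult)
      finally have "(1 + \<bar>real_of_int l\<bar>) powr (t - 1/2) * (\<Sum>k\<le>nat \<bar>l\<bar>. (1 + real k) powr (-t))
          \<le> (2 powr (t - 1/2) * jbr l powr (t - 1/2)) * S"
        by (intro mult_mono S) (auto intro!: sum_nonneg)
      then show "(1 + \<bar>real_of_int l\<bar>) powr (t - 1/2) * (\<Sum>k\<le>nat \<bar>l\<bar>. (1 + real k) powr (-t))
          \<le> 2 powr (t - 1/2) * S * rho t l"
        using 3 by (simp add: rho_def mult_ac)
    qed (use Spos in auto)
  qed
qed

text \<open>Each natural number is the absolute value of at most two integers; counting 0 twice is
  harmless since \<open>f\<close> is nonnegative.\<close>

lemma sum_int_abs_le:
  fixes f :: "nat \<Rightarrow> real"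
  assumes "finite B" "\<And>m. m \<in> A \<Longrightarrow> nat \<bar>m\<bar> \<in> B" "\<And>k. f k \<ge> 0"
  shows "(\<Sum>m\<in>A. f (nat \<bar>m\<bar>)) \<le> 2 * (\<Sum>k\<in>B. f k)"
proof -
  have "A \<subseteq> int ` B \<union> (\<lambda>k. - int k) ` B"
  proof
    fix m assume "m \<in> A"
    moreover have "m = int (nat \<bar>m\<bar>) \<or> m = - int (nat \<bar>m\<bar>)" by auto
    ultimately show "m \<in> int ` B \<union> (\<lambda>k. - int k) ` B" using assms(2) by blast
  qed
  then have "(\<Sum>m\<in>A. f (nat \<bar>m\<bar>)) \<le> (\<Sum>m\<in>int ` B \<union> (\<lambda>k. - int k) ` B. f (nat \<bar>m\<bar>))"
    using assms by (intro sum_mono2) auto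
  also have "\<dots> \<le> (\<Sum>m\<in>int ` B. f (nat \<bar>m\<bar>)) + (\<Sum>m\<in>(\<lambda>k. - int k) ` B. f (nat \<bar>m\<bar>))"
    using assms by (simp add: sum_Un sum_nonneg)
  also have "\<dots> = 2 * (\<Sum>k\<in>B. f k)"
    by (simp add: sum.reindex inj_on_def)
  finally show ?thesis .
qed

lemma sum_exp_abs_bounded:
  fixes c :: real
  assumes "c > 0"
  obtains E where "E > 0" "\<And>A::int set. finite A \<Longrightarrow> (\<Sum>m\<in>A. exp (- c * \<bar>real_of_int m\<bar>)) \<le> E"
proof
  define x where "x = exp (- c)"
  have x: "0 < x" "x < 1" using assms by (auto simp: x_def)
  show "2 * (1 / (1 - x)) > 0" using x by simp
  fix A :: "int set" assume A: "finite A"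
  have eq: "exp (- c * \<bar>real_of_int m\<bar>) = x ^ nat \<bar>m\<bar>" for m
    by (simp add: x_def mult.commute flip: exp_of_nat_mult)
  have "(\<Sum>m\<in>A. exp (- c * \<bar>real_of_int m\<bar>)) \<le> 2 * (\<Sum>k\<in>(\<lambda>m. nat \<bar>m\<bar>) ` A. x ^ k)"
    unfolding eq using x A by (intro sum_int_abs_le) auto
  also have "(\<Sum>k\<in>(\<lambda>m. nat \<bar>m\<bar>) ` A. x ^ k) \<le> (\<Sum>k. x ^ k)"
    using x A by (intro sum_le_suminf) (auto intro!: summable_geometric)
  also have "(\<Sum>k. x ^ k) = 1 / (1 - x)" using x by (intro suminf_geometric) auto
  finally show "(\<Sum>m\<in>A. exp (- c * \<bar>real_of_int m\<bar>)) \<le> 2 * (1 / (1 - x))" by simp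
qed

text \<open>The size of the Beta factor in position \<open>(n, m)\<close> predicted by Stirling's formula.\<close>
definition beta_majorant :: "real \<Rightarrow> real \<Rightarrow> int \<Rightarrow> int \<Rightarrow> real" where
  "beta_majorant c t n m = (1 + \<bar>real_of_int (n - m)\<bar>) powr (-1/2) *
     (((1 + \<bar>real_of_int n\<bar>) / (1 + \<bar>real_of_int m\<bar>)) powr t +
      ((1 + \<bar>real_of_int m\<bar>) / (1 + \<bar>real_of_int n\<bar>)) powr t) *
     exp (- c * (\<bar>real_of_int n\<bar> + \<bar>real_of_int m\<bar> - \<bar>real_of_int (n - m)\<bar>))"

lemma beta_majorant_nonneg: "0 \<le> beta_majorant c t n m"
  by (simp add: beta_majorant_def)

text \<open>Either \<open>0\<close> lies between \<open>n\<close> and \<open>m\<close>, and the exponent vanishes, or the exponent is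
  \<open>- 2 * c * min \<bar>n\<bar> \<bar>m\<bar>\<close>.\<close>
lemma ratio_powr_exp_le:
  fixes n m :: int
  assumes "c > 0" "t > 0"
  shows "((1 + \<bar>real_of_int n\<bar>) / (1 + \<bar>real_of_int m\<bar>)) powr t *
     exp (- c * (\<bar>real_of_int n\<bar> + \<bar>real_of_int m\<bar> - \<bar>real_of_int (n - m)\<bar>))
   \<le> (1 + \<bar>real_of_int (n - m)\<bar>) powr t *
       ((if \<bar>m\<bar> \<le> \<bar>n - m\<bar> then (1 + \<bar>real_of_int m\<bar>) powr (-t) else 0) +
        exp (- (2*c) * \<bar>real_of_int n\<bar>) + exp (- (2*c) * \<bar>real_of_int m\<bar>))"
proof -
  define x where "x = real_of_int n"
  define y where "y = real_of_int m"
  have L: "real_of_int (n - m) = x - y" by (simp add: x_def y_def)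
  define q where "q = (1 + \<bar>x\<bar>) / (1 + \<bar>y\<bar>)"
  have q: "q > 0" by (simp add: q_def add_pos_nonneg)
  show ?thesis
  proof (cases "\<bar>x\<bar> + \<bar>y\<bar> = \<bar>x - y\<bar>")
    case True
    then have "\<bar>real_of_int m\<bar> \<le> \<bar>real_of_int (n - m)\<bar>" unfolding L unfolding x_def y_def by linarith
    then have le: "\<bar>m\<bar> \<le> \<bar>n - m\<bar>" by linarith
    have "q \<le> (1 + \<bar>x - y\<bar>) / (1 + \<bar>y\<bar>)"
      unfolding q_def using True by (intro divide_right_mono) auto
    then have "q powr t \<le> ((1 + \<bar>x - y\<bar>) / (1 + \<bar>y\<bar>)) powr t"
      using q assms by (intro powr_mono2) auto
    also have "\<dots> = (1 + \<bar>x - y\<bar>) powr t * (1 + \<bar>y\<bar>) powr (-t)"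
      by (simp add: powr_divide powr_minus_divide)
    finally have 1: "q powr t \<le> (1 + \<bar>x - y\<bar>) powr t * (1 + \<bar>y\<bar>) powr (-t)" .
    have "q powr t * exp (- c * (\<bar>x\<bar> + \<bar>y\<bar> - \<bar>x - y\<bar>)) = q powr t" using True by simp
    also note 1
    also have "(1 + \<bar>x - y\<bar>) powr t * (1 + \<bar>y\<bar>) powr (-t) \<le> (1 + \<bar>x - y\<bar>) powr t *
       ((1 + \<bar>y\<bar>) powr (-t) + exp (- (2*c) * \<bar>x\<bar>) + exp (- (2*c) * \<bar>y\<bar>))"
      by (intro mult_left_mono) auto
    finally show ?thesis using le unfolding L by (simp add: x_def y_def q_def)
  next
    case False
    then have min: "\<bar>x\<bar> + \<bar>y\<bar> - \<bar>x - y\<bar> = 2 * \<bar>x\<bar> \<or> \<bar>x\<bar> + \<bar>y\<bar> - \<bar>x - y\<bar> = 2 * \<bar>y\<bar>"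
      by linarith
    have "0 \<le> \<bar>y\<bar> * \<bar>x - y\<bar>" by simp
    then have "1 + \<bar>x\<bar> \<le> (1 + \<bar>x - y\<bar>) * (1 + \<bar>y\<bar>)"
      unfolding distrib_left distrib_right by (simp only: mult.commute mult_1_left mult_1_right)
    then have "q \<le> 1 + \<bar>x - y\<bar>" by (simp add: q_def divide_le_eq add_pos_nonneg)
    then have 1: "q powr t \<le> (1 + \<bar>x - y\<bar>) powr t"
      using q assms by (intro powr_mono2) auto
    have 2: "exp (- c * (\<bar>x\<bar> + \<bar>y\<bar> - \<bar>x - y\<bar>)) \<le>
        z + exp (- (2*c) * \<bar>x\<bar>) + exp (- (2*c) * \<bar>y\<bar>)" if "z \<ge> 0" for z
    proof -
      have e: "exp (- c * (2 * u)) = exp (- (2*c) * u)" for u by (simp add: mult_ac)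
      from min show ?thesis
      proof (elim disjE)
        assume m: "\<bar>x\<bar> + \<bar>y\<bar> - \<bar>x - y\<bar> = 2 * \<bar>x\<bar>"
        show ?thesis unfolding m e using that by (simp add: add_nonneg_nonneg)
      next
        assume m: "\<bar>x\<bar> + \<bar>y\<bar> - \<bar>x - y\<bar> = 2 * \<bar>y\<bar>"
        show ?thesis unfolding m e using that by (simp add: add_nonneg_nonneg)
      qed
    qed
    show ?thesis
      using mult_mono[OF 1 2] unfolding L by (simp add: x_def y_def q_def)
  qed
qed

text \<open>On a diagonal the pointwise bound leaves \<open>X powr (t - 1/2)\<close> times a power
  sum over \<open>\<bar>m\<bar> \<le> \<bar>l\<bar>\<close> and exponentials with bounded sum. The
  second ratio in the majorant is treated by exchanging \<open>n\<close> and \<open>m\<close>, hence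
  the terms at \<open>m + l\<close>.\<close>

lemma sum_beta_majorant_le:
  assumes "c > 0" "t > 0"
  obtains C where "C > 0"
    "\<And>l A. finite A \<Longrightarrow> (\<Sum>m\<in>A. beta_majorant c t (m + l) m) \<le> C * rho t l"
proof -
  obtain E where E: "E > 0" "\<And>A::int set. finite A \<Longrightarrow> (\<Sum>m\<in>A. exp (- (2*c) * \<bar>real_of_int m\<bar>)) \<le> E"
    using sum_exp_abs_bounded[of "2*c"] assms by auto
  obtain R where R: "R > 0"
    "\<And>l. (1 + \<bar>real_of_int l\<bar>) powr (t - 1/2) * (\<Sum>k\<le>nat \<bar>l\<bar>. (1 + real k) powr (-t)) \<le> R * rho t l"
    using weighted_partial_sum_le_rho[OF assms(2)] by blast
  show thesis
  proof (rule that[of "(4 + 4 * E) * R"])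
    fix l :: int and A :: "int set"
    assume A: "finite A"
    define S where "S = (\<Sum>k\<le>nat \<bar>l\<bar>. (1 + real k) powr (-t))"
    define X where "X = 1 + \<bar>real_of_int l\<bar>"
    define g where "g m = (if \<bar>m\<bar> \<le> \<bar>l\<bar> then (1 + \<bar>real_of_int m\<bar>) powr (-t) else 0)" for m
    define h where "h m = exp (- (2*c) * \<bar>real_of_int m\<bar>)" for m :: int
    have X: "X > 0" by (simp add: X_def)
    \<comment> \<open>The term \<open>k = 0\<close> already gives 1; this lets the exponential sums,
      bounded by \<open>E\<close>, be absorbed into \<open>S\<close> at the end.\<close>
    have S: "S \<ge> 1"
    proof -
      have "(\<Sum>k\<in>{0}. (1 + real k) powr (-t)) \<le> S" unfolding S_def by (intro sum_mono2) auto
      then show ?thesis by simp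
    qed
    have g: "(\<Sum>m\<in>B. g m) \<le> 2 * S" if "finite B" for B
    proof -
      have "(\<Sum>m\<in>B. g m) = (\<Sum>m\<in>{m\<in>B. \<bar>m\<bar> \<le> \<bar>l\<bar>}. (1 + \<bar>real_of_int m\<bar>) powr (-t))"
        unfolding g_def using that by (simp add: sum.inter_filter)
      also have "\<dots> \<le> 2 * S" 
        using sum_int_abs_le[of "{..nat \<bar>l\<bar>}" "{m\<in>B. \<bar>m\<bar> \<le> \<bar>l\<bar>}" "\<lambda>k. (1 + real k) powr (-t)"]
        by (simp add: S_def nat_le_iff)
      finally show ?thesis .
    qed
    \<comment> \<open>The bounds for \<open>g\<close> and \<open>h\<close> hold over any finite set,
      so the terms at \<open>m + l\<close> are summed over the translate of
      \<open>A\<close>.\<close>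
    have shift: "(\<Sum>m\<in>A. f (m + l)) = (\<Sum>m\<in>(\<lambda>m. m + l) ` A. f m)" for f :: "int \<Rightarrow> real"
      by (simp add: sum.reindex inj_on_def)
    have "beta_majorant c t (m + l) m \<le> X powr (-1/2) * (X powr t *
       (g m + g (m + l) + 2 * h (m + l) + 2 * h m))" for m
    proof -
      have 1: "((1 + \<bar>real_of_int (m + l)\<bar>) / (1 + \<bar>real_of_int m\<bar>)) powr t *
          exp (- c * (\<bar>real_of_int (m + l)\<bar> + \<bar>real_of_int m\<bar> - \<bar>real_of_int l\<bar>))
          \<le> X powr t * (g m + h (m + l) + h m)"
        using ratio_powr_exp_le[OF assms, of "m + l" m] by (simp add: X_def g_def h_def)
      have 2: "((1 + \<bar>real_of_int m\<bar>) / (1 + \<bar>real_of_int (m + l)\<bar>)) powr t *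
          exp (- c * (\<bar>real_of_int (m + l)\<bar> + \<bar>real_of_int m\<bar> - \<bar>real_of_int l\<bar>))
          \<le> X powr t * (g (m + l) + h m + h (m + l))"
      proof -
        have "\<bar>m - (m + l)\<bar> = \<bar>l\<bar>" "\<bar>real_of_int (m - (m + l))\<bar> = \<bar>real_of_int l\<bar>"
          by simp_all
        with ratio_powr_exp_le[OF assms, of m "m + l"] show ?thesis
          unfolding X_def g_def h_def by (simp only: add_ac)
      qed
      have "beta_majorant c t (m + l) m = X powr (-1/2) *
          (((1 + \<bar>real_of_int (m + l)\<bar>) / (1 + \<bar>real_of_int m\<bar>)) powr t *
          exp (- c * (\<bar>real_of_int (m + l)\<bar> + \<bar>real_of_int m\<bar> - \<bar>real_of_int l\<bar>)) +
          ((1 + \<bar>real_of_int m\<bar>) / (1 + \<bar>real_of_int (m + l)\<bar>)) powr t *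
          exp (- c * (\<bar>real_of_int (m + l)\<bar> + \<bar>real_of_int m\<bar> - \<bar>real_of_int l\<bar>)))"
        by (simp add: beta_majorant_def X_def algebra_simps)
      also have "\<dots> \<le> X powr (-1/2) *
          (X powr t * (g m + h (m + l) + h m) + X powr t * (g (m + l) + h m + h (m + l)))"
        by (intro mult_left_mono add_mono 1 2) auto
      finally show ?thesis by (simp add: algebra_simps)
    qed
    then have "(\<Sum>m\<in>A. beta_majorant c t (m + l) m) \<le> (\<Sum>m\<in>A. X powr (-1/2) * (X powr t *
       (g m + g (m + l) + 2 * h (m + l) + 2 * h m)))"
      by (rule sum_mono)
    also have "\<dots> = X powr (t - 1/2) *
        ((\<Sum>m\<in>A. g m) + (\<Sum>m\<in>A. g (m + l)) + 2 * (\<Sum>m\<in>A. h (m + l)) + 2 * (\<Sum>m\<in>A. h m))"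
    proof -
      have "X powr (t - 1/2) = X powr (-1/2) * X powr t" by (simp flip: powr_add)
      then show ?thesis by (simp add: sum.distrib mult.assoc flip: sum_distrib_left)
    qed
    also have "\<dots> \<le> X powr (t - 1/2) * (2 * S + 2 * S + 2 * E + 2 * E)"
      unfolding shift[of g] shift[of h]
      using A E(2)[folded h_def] by (intro mult_left_mono add_mono g) auto
    also have "\<dots> \<le> X powr (t - 1/2) * ((4 + 4 * E) * S)"
      using E(1) S by (intro mult_left_mono) (auto simp: algebra_simps)
    also have "\<dots> = (4 + 4 * E) * (X powr (t - 1/2) * S)" by simp
    also have "\<dots> \<le> (4 + 4 * E) * (R * rho t l)"
      using R(2)[of l] E(1) by (intro mult_left_mono) (auto simp: X_def S_def)
    finally show "(\<Sum>m\<in>A. beta_majorant c t (m + l) m) \<le> (4 + 4 * E) * R * rho t l"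
      by (simp add: mult_ac)
  qed (use E(1) R(1) in auto)
qed

text \<open>In the coordinates difference and shifted column, \<open>j\<close> only translates along
  each diagonal, so the bound is independent of \<open>j\<close>. This gives the uniformity in
  \<open>Re s\<close>.\<close>

lemma double_sum_beta_majorant_le:
  fixes a :: "int \<Rightarrow> real"
  assumes C: "\<And>l A. finite A \<Longrightarrow> (\<Sum>m\<in>A. beta_majorant c t (m + l) m) \<le> C * rho t l"
    and a: "\<And>l. a l \<ge> 0" and sm: "(\<lambda>l. a l * rho t l) summable_on UNIV"
    and "C > 0" and F: "finite F"
  shows "(\<Sum>(n,m)\<in>F. beta_majorant c t (n + j) (m + j) * a (n - m)) \<le> C * (\<Sum>\<^sub>\<infinity>l. a l * rho t l)"
proof -
  define \<phi> where "\<phi> = (\<lambda>(n, m). (n - m, m + j))"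
  define P where "P = fst ` \<phi> ` F"
  define Q where "Q = snd ` \<phi> ` F"
  have fin: "finite P" "finite Q" using F by (auto simp: P_def Q_def)
  have "inj_on \<phi> F" by (auto simp: inj_on_def \<phi>_def)
  then have "(\<Sum>(n,m)\<in>F. beta_majorant c t (n + j) (m + j) * a (n - m)) =
      (\<Sum>(l,m)\<in>\<phi> ` F. beta_majorant c t (m + l) m * a l)"
    by (subst sum.reindex) (auto simp: \<phi>_def case_prod_beta add_ac intro!: sum.cong)
  \<comment> \<open>Filling up to a rectangle adds nonnegative terms and separates the sum into
    diagonals.\<close>
  also have "\<dots> \<le> (\<Sum>(l,m)\<in>P \<times> Q. beta_majorant c t (m + l) m * a l)"
  proof (intro sum_mono2)
    show "\<phi> ` F \<subseteq> P \<times> Q" unfolding P_def Q_def by (intro subsetI) (simp add: mem_Times_iff)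
  qed (use fin a in \<open>auto simp: beta_majorant_nonneg\<close>)
  also have "\<dots> = (\<Sum>l\<in>P. (\<Sum>m\<in>Q. beta_majorant c t (m + l) m) * a l)"
    by (simp add: sum.cartesian_product sum_distrib_right)
  also have "\<dots> \<le> (\<Sum>l\<in>P. C * rho t l * a l)"
    using fin a by (intro sum_mono mult_right_mono C) auto
  also have "\<dots> = C * (\<Sum>l\<in>P. a l * rho t l)"
    by (simp add: sum_distrib_left mult_ac)
  also have "\<dots> \<le> C * (\<Sum>\<^sub>\<infinity>l. a l * rho t l)"
    using fin a \<open>C > 0\<close> by (intro mult_left_mono finite_sum_le_infsum sm) (auto simp: rho_nonneg)
  finally show ?thesis .
qed

section \<open>The matrix of the Beta function\<close>

text \<open>Up to the unit factors \<open>- \<i>\<close> and \<open>\<i>\<close>, each quantity is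
  the difference of \<open>s\<close> and a point of \<open>Lam T\<close>: the poles of the first
  Gamma factor give the points with negative imaginary part, those of the second the points with
  positive one.\<close>

lemma Kset_dist_poles:
  assumes "s \<in> Kset T t d"
  shows "d \<le> cmod (1/2 - \<i> * of_real (omega T) * of_int n - \<i> * s + of_nat k)"
    and "d \<le> cmod (1/2 + \<i> * of_real (omega T) * of_int m + \<i> * s + of_nat k)"
proof -
  have d: "d \<le> dist s w" if "w \<in> Lam T" for w
    using assms infdist_le[OF that, of s] by (simp add: Kset_def)
  have "complex_of_real (omega T * of_int (-n)) + \<i> * (of_int (- int k - 1) + 1/2) \<in> Lam T"
    unfolding Lam_def by blast
  from d[OF this]
  have "d \<le> cmod (- \<i> * (s - (complex_of_real (omega T * of_int (-n)) + \<i> * (of_int (- int k - 1) + 1/2))))"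
    unfolding norm_mult by (simp add: dist_norm)
  also have "- \<i> * (s - (complex_of_real (omega T * of_int (-n)) + \<i> * (of_int (- int k - 1) + 1/2))) =
      1/2 - \<i> * of_real (omega T) * of_int n - \<i> * s + of_nat k"
    by (simp add: complex_eq_iff)
  finally show "d \<le> cmod (1/2 - \<i> * of_real (omega T) * of_int n - \<i> * s + of_nat k)" .
  have "complex_of_real (omega T * of_int (-m)) + \<i> * (of_int (int k) + 1/2) \<in> Lam T"
    unfolding Lam_def by blast
  from d[OF this]
  have "d \<le> cmod (\<i> * (s - (complex_of_real (omega T * of_int (-m)) + \<i> * (of_int (int k) + 1/2))))"
    unfolding norm_mult by (simp add: dist_norm)
  also have "\<i> * (s - (complex_of_real (omega T * of_int (-m)) + \<i> * (of_int (int k) + 1/2))) =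
      1/2 + \<i> * of_real (omega T) * of_int m + \<i> * s + of_nat k"
    by (simp add: complex_eq_iff)
  finally show "d \<le> cmod (1/2 + \<i> * of_real (omega T) * of_int m + \<i> * s + of_nat k)" .
qed

text \<open>Removes the dependence on \<open>u = Im s\<close>: the first summand dominates for
  \<open>q \<ge> 1\<close>, the second for \<open>q < 1\<close>. This is why the majorant contains
  both ratios.\<close>

lemma powr_le_powr_add_powr_inverse:
  fixes q :: real
  assumes "q > 0" "\<bar>u\<bar> \<le> t"
  shows "q powr u \<le> q powr t + (1/q) powr t"
proof (cases "q \<ge> 1")
  case True
  then have "q powr u \<le> q powr t" using assms by (intro powr_mono) auto
  then show ?thesis by (simp add: add_increasing2)
next
  case False
  then have "q powr u \<le> q powr (-t)" using assms by (intro powr_mono') auto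
  also have "\<dots> = (1/q) powr t" using assms by (simp add: powr_minus_divide powr_divide)
  finally show ?thesis by (simp add: add_increasing)
qed

text \<open>Serves to pass from the ordinates of the Gamma arguments to integers; one constant
  \<open>P\<close> covers both directions.\<close>

lemma one_plus_abs_affine_comparable:
  fixes w R x e :: real
  assumes "w > 0" "\<bar>e\<bar> \<le> R"
  defines "P \<equiv> 1 + w + R + 1/w + R/w"
  shows "1 + \<bar>w * x + e\<bar> \<le> P * (1 + \<bar>x\<bar>)" "1 + \<bar>x\<bar> \<le> P * (1 + \<bar>w * x + e\<bar>)"
proof -
  have R: "R \<ge> 0" using assms by linarith
  have P: "P \<ge> 1 + w + R" "P \<ge> 1 + 1/w + R/w" using assms R by (auto simp: P_def)
  have "\<bar>w * x + e\<bar> \<le> \<bar>w * x\<bar> + \<bar>e\<bar>" by (rule abs_triangle_ineq)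
  then have "1 + \<bar>w * x + e\<bar> \<le> 1 + w * \<bar>x\<bar> + R" using assms by (simp add: abs_mult)
  also have "\<dots> \<le> (1 + w + R) * (1 + \<bar>x\<bar>)"
    using assms R by (simp add: algebra_simps)
  also have "\<dots> \<le> P * (1 + \<bar>x\<bar>)" using P by (intro mult_right_mono) auto
  finally show "1 + \<bar>w * x + e\<bar> \<le> P * (1 + \<bar>x\<bar>)" .
  have "\<bar>w * x\<bar> \<le> \<bar>w * x + e\<bar> + \<bar>e\<bar>" by linarith
  then have "w * \<bar>x\<bar> \<le> \<bar>w * x + e\<bar> + R" using assms by (simp add: abs_mult)
  then have "\<bar>x\<bar> \<le> (\<bar>w * x + e\<bar> + R) / w" using assms by (simp add: field_simps)
  then have "1 + \<bar>x\<bar> \<le> 1 + (1/w) * \<bar>w * x + e\<bar> + R/w" by (simp add: add_divide_distrib)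
  also have "\<dots> \<le> (1 + 1/w + R/w) * (1 + \<bar>w * x + e\<bar>)"
    using assms R by (simp add: distrib_left distrib_right)
  also have "\<dots> \<le> P * (1 + \<bar>w * x + e\<bar>)" using P by (intro mult_right_mono) auto
  finally show "1 + \<bar>x\<bar> \<le> P * (1 + \<bar>w * x + e\<bar>)" .
qed

lemma ratio_powr_le:
  fixes a b x y P t :: real
  assumes "0 < a" "0 < b" "0 < x" "0 < y" "a \<le> P * x" "y \<le> P * b" "t \<ge> 0"
  shows "(a / b) powr t \<le> (P\<^sup>2) powr t * (x / y) powr t"
proof -
  have P: "P > 0" using assms by (smt (verit) zero_less_mult_iff)
  have "a * y \<le> (P * x) * (P * b)" using assms P by (intro mult_mono) auto
  then have "a / b \<le> P\<^sup>2 * (x / y)"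
    using assms by (simp add: field_simps power2_eq_square)
  then have "(a / b) powr t \<le> (P\<^sup>2 * (x / y)) powr t" using assms by (intro powr_mono2) auto
  also have "\<dots> = (P\<^sup>2) powr t * (x / y) powr t" using assms P by (intro powr_mult)
  finally show ?thesis .
qed

text \<open>The product of the vertical bounds for the three Gamma factors. The integer
  \<open>j\<close> absorbs \<open>Re s\<close> up to a remainder of size \<open>R\<close>, so the
  constant depends on neither \<open>s\<close> nor \<open>j\<close>.\<close>

lemma cmod_Beta_le_majorant:
  assumes "T > 0" "t > 0" "d > 0" "R \<ge> 0"
  obtains C where "C > 0"
    "\<And>s j n m. \<lbrakk>s \<in> Kset T t d; \<bar>Re s - omega T * of_int j\<bar> \<le> R\<rbrakk> \<Longrightarrow>
      cmod (Beta (1/2 - \<i> * of_real (omega T) * of_int n - \<i> * s)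
                 (1/2 + \<i> * of_real (omega T) * of_int m + \<i> * s))
       \<le> C * beta_majorant (pi * omega T / 2) t (n + j) (m + j)"
proof -
  define w where "w = omega T"
  have w: "w > 0" using assms by (simp add: w_def omega_def)
  define P where "P = 1 + w + R + 1/w + R/w"
  have P: "P > 0" using w assms by (simp add: P_def add_pos_nonneg)
  obtain G where G: "G > 0"
    "\<And>z. \<lbrakk>\<bar>Re z - 1/2\<bar> \<le> t; \<And>k::nat. cmod (z + of_nat k) \<ge> d\<rbrakk> \<Longrightarrow>
       cmod (Gamma z) \<le> G * (1 + \<bar>Im z\<bar>) powr (Re z - 1/2) * exp (- (pi * \<bar>Im z\<bar> / 2))"
    using Gamma_vertical_bound[of t d] assms by auto
  obtain D where D: "D > 0"
    "\<And>y. cmod (rGamma (Complex 1 y)) \<le> D * (1 + \<bar>y\<bar>) powr (-1/2) * exp (pi * \<bar>y\<bar> / 2)"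
    using rGamma_vertical_bound by blast
  show thesis
  \<comment> \<open>Besides the Gamma constants: \<open>P powr (1/2)\<close> comes from the weight
    of \<open>x - y\<close>, \<open>(P\<^sup>2) powr t\<close> from the ratio, and
    \<open>exp (pi * R)\<close> from replacing \<open>a\<close> and \<open>b\<close> by
    \<open>w * x\<close> and \<open>w * y\<close> in the exponent.\<close>
  proof (rule that[of "G * G * D * (P powr (1/2) * (P\<^sup>2) powr t * exp (pi * R))"])
    fix s :: complex and j n m :: int
    assume s: "s \<in> Kset T t d" and sj: "\<bar>Re s - omega T * of_int j\<bar> \<le> R"
    define u where "u = Im s"
    have u: "\<bar>u\<bar> < t" using s by (simp add: Kset_def u_def)
    define z1 where "z1 = 1/2 - \<i> * of_real (omega T) * of_int n - \<i> * s"
    define z2 where "z2 = 1/2 + \<i> * of_real (omega T) * of_int m + \<i> * s"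
    define e where "e = Re s - w * of_int j"
    have e: "\<bar>e\<bar> \<le> R" using sj by (simp add: e_def w_def)
    define x where "x = real_of_int (n + j)"
    define y where "y = real_of_int (m + j)"
    define a where "a = w * x + e"
    define b where "b = w * y + e"
    have z1: "Re z1 = 1/2 + u" "Im z1 = - a"
      by (simp_all add: z1_def u_def a_def x_def e_def w_def algebra_simps)
    have z2: "Re z2 = 1/2 - u" "Im z2 = b"
      by (simp_all add: z2_def u_def b_def y_def e_def w_def algebra_simps)
    \<comment> \<open>The terms in \<open>s\<close> cancel, so the denominator stays on the line of
      real part 1.\<close>
    have z12: "z1 + z2 = Complex 1 (- (w * (x - y)))"
      by (simp add: complex_eq_iff z1 z2 a_def b_def algebra_simps)
    define q where "q = (1 + \<bar>a\<bar>) / (1 + \<bar>b\<bar>)"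
    have q: "q > 0" by (simp add: q_def add_pos_nonneg)
    have g1: "cmod (Gamma z1) \<le> G * (1 + \<bar>a\<bar>) powr u * exp (- (pi * \<bar>a\<bar> / 2))"
      using G(2)[of z1] Kset_dist_poles(1)[OF s, of n] u z1 by (simp add: z1_def)
    have g2: "cmod (Gamma z2) \<le> G * (1 + \<bar>b\<bar>) powr (-u) * exp (- (pi * \<bar>b\<bar> / 2))"
      using G(2)[of z2] Kset_dist_poles(2)[OF s, of m] u z2 by (simp add: z2_def)
    have g3: "cmod (rGamma (z1 + z2)) \<le> D * (1 + w * \<bar>x - y\<bar>) powr (-1/2) * exp (pi * (w * \<bar>x - y\<bar>) / 2)"
      using D(2)[of "- (w * (x - y))"] w unfolding z12 by (simp add: abs_mult)
    have "cmod (Beta z1 z2) = cmod (Gamma z1) * cmod (Gamma z2) * cmod (rGamma (z1 + z2))"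
      by (simp add: Beta_altdef norm_mult)
    also have "\<dots> \<le> (G * (1 + \<bar>a\<bar>) powr u * exp (- (pi * \<bar>a\<bar> / 2))) *
        (G * (1 + \<bar>b\<bar>) powr (-u) * exp (- (pi * \<bar>b\<bar> / 2))) *
        (D * (1 + w * \<bar>x - y\<bar>) powr (-1/2) * exp (pi * (w * \<bar>x - y\<bar>) / 2))"
      using G(1) by (intro mult_mono g1 g2 g3) auto
    also have "\<dots> = G * G * D * ((1 + w * \<bar>x - y\<bar>) powr (-1/2) * ((1 + \<bar>a\<bar>) powr u * (1 + \<bar>b\<bar>) powr (-u)) *
        (exp (- (pi * \<bar>a\<bar> / 2)) * exp (- (pi * \<bar>b\<bar> / 2)) * exp (pi * (w * \<bar>x - y\<bar>) / 2)))"
      by (simp only: mult_ac)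
    also have "(1 + \<bar>a\<bar>) powr u * (1 + \<bar>b\<bar>) powr (-u) = q powr u"
      by (simp add: q_def powr_divide powr_minus_divide)
    also have "G * G * D * ((1 + w * \<bar>x - y\<bar>) powr (-1/2) * q powr u *
        (exp (- (pi * \<bar>a\<bar> / 2)) * exp (- (pi * \<bar>b\<bar> / 2)) * exp (pi * (w * \<bar>x - y\<bar>) / 2))) \<le>
      G * G * D * ((P powr (1/2) * (1 + \<bar>x - y\<bar>) powr (-1/2)) *
        ((P\<^sup>2) powr t * (((1 + \<bar>x\<bar>) / (1 + \<bar>y\<bar>)) powr t + ((1 + \<bar>y\<bar>) / (1 + \<bar>x\<bar>)) powr t)) *
        (exp (pi * R) * exp (- (pi * w / 2) * (\<bar>x\<bar> + \<bar>y\<bar> - \<bar>x - y\<bar>))))"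
    proof (rule mult_left_mono[OF mult_mono[OF mult_mono]])
      have "1 + \<bar>x - y\<bar> \<le> P * (1 + \<bar>w * (x - y) + 0\<bar>)"
        unfolding P_def by (rule one_plus_abs_affine_comparable) (use w assms in auto)
      also have "\<bar>w * (x - y) + 0\<bar> = w * \<bar>x - y\<bar>" using w by (simp add: abs_mult)
      finally have "(1 + \<bar>x - y\<bar>) / P \<le> 1 + w * \<bar>x - y\<bar>"
        using P by (simp add: pos_divide_le_eq mult.commute)
      then have "(1 + w * \<bar>x - y\<bar>) powr (-1/2) \<le> ((1 + \<bar>x - y\<bar>) / P) powr (-1/2)"
        using P by (intro powr_mono2') (auto intro!: divide_pos_pos add_pos_nonneg)
      also have "\<dots> = P powr (1/2) * (1 + \<bar>x - y\<bar>) powr (-1/2)"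
        using P by (simp add: powr_divide powr_minus field_simps)
      finally show "(1 + w * \<bar>x - y\<bar>) powr (-1/2) \<le> P powr (1/2) * (1 + \<bar>x - y\<bar>) powr (-1/2)" .
      have cmp: "1 + \<bar>a\<bar> \<le> P * (1 + \<bar>x\<bar>)" "1 + \<bar>x\<bar> \<le> P * (1 + \<bar>a\<bar>)"
           "1 + \<bar>b\<bar> \<le> P * (1 + \<bar>y\<bar>)" "1 + \<bar>y\<bar> \<le> P * (1 + \<bar>b\<bar>)"
        unfolding P_def a_def b_def using one_plus_abs_affine_comparable[OF w e] by auto
      have "q powr u \<le> q powr t + (1/q) powr t"
        using q u by (intro powr_le_powr_add_powr_inverse) auto
      also have "1/q = (1 + \<bar>b\<bar>) / (1 + \<bar>a\<bar>)" by (simp add: q_def)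
      also have "q powr t + ((1 + \<bar>b\<bar>) / (1 + \<bar>a\<bar>)) powr t \<le>
          (P\<^sup>2) powr t * ((1 + \<bar>x\<bar>) / (1 + \<bar>y\<bar>)) powr t + (P\<^sup>2) powr t * ((1 + \<bar>y\<bar>) / (1 + \<bar>x\<bar>)) powr t"
        unfolding q_def using assms cmp by (intro add_mono ratio_powr_le) auto
      finally show "q powr u \<le> (P\<^sup>2) powr t * (((1 + \<bar>x\<bar>) / (1 + \<bar>y\<bar>)) powr t + ((1 + \<bar>y\<bar>) / (1 + \<bar>x\<bar>)) powr t)"
        by (simp add: distrib_left)
      have "w * \<bar>x\<bar> \<le> \<bar>a\<bar> + R" "w * \<bar>y\<bar> \<le> \<bar>b\<bar> + R"
      proof -
        have "\<bar>w * x\<bar> \<le> \<bar>a\<bar> + \<bar>e\<bar>" "\<bar>w * y\<bar> \<le> \<bar>b\<bar> + \<bar>e\<bar>" unfolding a_def b_def by linarith+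
        then show "w * \<bar>x\<bar> \<le> \<bar>a\<bar> + R" "w * \<bar>y\<bar> \<le> \<bar>b\<bar> + R" using w e by (auto simp: abs_mult)
      qed
      then have "pi * (w * \<bar>x\<bar> + w * \<bar>y\<bar>) \<le> pi * (\<bar>a\<bar> + \<bar>b\<bar> + 2 * R)"
        by (intro mult_left_mono) auto
      then have "- (pi * \<bar>a\<bar> / 2) + - (pi * \<bar>b\<bar> / 2) + pi * (w * \<bar>x - y\<bar>) / 2 \<le>
          pi * R + - (pi * w / 2) * (\<bar>x\<bar> + \<bar>y\<bar> - \<bar>x - y\<bar>)"
        by (simp add: algebra_simps)
      then show "exp (- (pi * \<bar>a\<bar> / 2)) * exp (- (pi * \<bar>b\<bar> / 2)) * exp (pi * (w * \<bar>x - y\<bar>) / 2) \<le>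
          exp (pi * R) * exp (- (pi * w / 2) * (\<bar>x\<bar> + \<bar>y\<bar> - \<bar>x - y\<bar>))"
        by (simp only: exp_le_cancel_iff flip: exp_add)
    qed (use G D P in auto)
    also have "\<dots> = G * G * D * (P powr (1/2) * (P\<^sup>2) powr t * exp (pi * R)) *
        beta_majorant (pi * omega T / 2) t (n + j) (m + j)"
    proof -
      have "real_of_int ((n + j) - (m + j)) = x - y" by (simp add: x_def y_def)
      then show ?thesis
        unfolding beta_majorant_def x_def[symmetric] y_def[symmetric] w_def[symmetric]
        by (simp only: mult_ac)
    qed
    finally show "cmod (Beta (1/2 - \<i> * of_real (omega T) * of_int n - \<i> * s)
                 (1/2 + \<i> * of_real (omega T) * of_int m + \<i> * s))
       \<le> G * G * D * (P powr (1/2) * (P\<^sup>2) powr t * exp (pi * R)) *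
        beta_majorant (pi * omega T / 2) t (n + j) (m + j)"
      unfolding z1_def z2_def .
  qed (use G D P in auto)
qed

section \<open>Analyticity of the entries and proof of the theorem\<close>

lemma Hmat_holomorphic_on_Kset:
  assumes "d > 0"
  shows "(\<lambda>z. Hmat T p z n m) holomorphic_on Kset T t d"
  unfolding Hmat_def Beta_altdef
  by (intro holomorphic_intros)
     (auto intro!: not_nonpos_Int_if_dist[OF assms] Kset_dist_poles)

text \<open>Half of the distance to \<open>Lam T\<close> is kept as a uniform separation on the
  ball, so the constants for a positive \<open>d\<close> apply locally.\<close>

lemma ball_subset_Kset:
  assumes "s \<in> Kset T t 0"
  obtains r d where "r > 0" "d > 0" "ball s r \<subseteq> Kset T t d"
proof -
  define e where "e = infdist s (Lam T)"
  have e: "e > 0" "\<bar>Im s\<bar> < t" using assms by (auto simp: Kset_def e_def)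
  show thesis
  proof (rule that[of "min (e/2) (t - \<bar>Im s\<bar>)" "e/2"])
    show "ball s (min (e/2) (t - \<bar>Im s\<bar>)) \<subseteq> Kset T t (e/2)"
    proof
      fix z assume z: "z \<in> ball s (min (e/2) (t - \<bar>Im s\<bar>))"
      have "e \<le> infdist z (Lam T) + dist s z" unfolding e_def by (rule infdist_triangle)
      moreover have "\<bar>Im s - Im z\<bar> \<le> dist s z"
        using abs_Im_le_cmod[of "s - z"] by (simp add: dist_norm)
      ultimately show "z \<in> Kset T t (e/2)" using z by (auto simp: Kset_def)
    qed
  qed (use e in auto)
qed

theorem theorem3p1:
  fixes T \<tau>0 :: real
  assumes "T > 0" and "\<tau>0 > 0"
  shows "(\<forall>p :: real \<Rightarrow> real.
            (\<forall>x. p (x + T) = p x) \<and> p absolutely_integrable_on {0..T} \<and>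
            (\<lambda>l. cmod (fcoef T p l) * rho \<tau>0 l) summable_on (UNIV :: int set)
            \<longrightarrow> trace_class_analytic_on (Hmat T p) (Kset T \<tau>0 0))
       \<and> (\<forall>\<delta>>0. \<exists>C :: real. \<forall>p :: real \<Rightarrow> real.
            (\<forall>x. p (x + T) = p x) \<and> p absolutely_integrable_on {0..T} \<and>
            (\<lambda>l. cmod (fcoef T p l) * rho \<tau>0 l) summable_on (UNIV :: int set)
            \<longrightarrow> (\<forall>s\<in>Kset T \<tau>0 \<delta>.
                  trace_norm (Hmat T p s)
                    \<le> ereal (C * (\<Sum>\<^sub>\<infinity>l\<in>(UNIV :: int set). cmod (fcoef T p l) * rho \<tau>0 l))))"
proof -
  define w where "w = omega T"
  have w: "w > 0" using assms by (simp add: w_def omega_def)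
  define c where "c = pi * omega T / 2"
  have c: "c > 0" using w by (simp add: c_def w_def)
  obtain D where D: "D > 0"
    "\<And>l A. finite A \<Longrightarrow> (\<Sum>m\<in>A. beta_majorant c \<tau>0 (m + l) m) \<le> D * rho \<tau>0 l"
    using sum_beta_majorant_le[OF c assms(2)] by blast
  \<comment> \<open>One estimate serves both claims: it holds for every shift \<open>j\<close>, and
    \<open>D\<close> does not depend on \<open>p\<close>.\<close>
  have majorant_sum: "(\<Sum>(n,m)\<in>F. C * beta_majorant c \<tau>0 (n + j) (m + j) * cmod (fcoef T p (n - m)))
      \<le> C * D * (\<Sum>\<^sub>\<infinity>l. cmod (fcoef T p l) * rho \<tau>0 l)"
    if "(\<lambda>l. cmod (fcoef T p l) * rho \<tau>0 l) summable_on UNIV" "finite F" "C > 0" for F C j p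
  proof -
    have "(\<Sum>(n,m)\<in>F. C * beta_majorant c \<tau>0 (n + j) (m + j) * cmod (fcoef T p (n - m))) =
        C * (\<Sum>(n,m)\<in>F. beta_majorant c \<tau>0 (n + j) (m + j) * cmod (fcoef T p (n - m)))"
      by (simp add: sum_distrib_left case_prod_beta mult.assoc)
    also have "\<dots> \<le> C * (D * (\<Sum>\<^sub>\<infinity>l. cmod (fcoef T p l) * rho \<tau>0 l))"
      using that by (intro mult_left_mono double_sum_beta_majorant_le D) auto
    finally show ?thesis by (simp add: mult.assoc)
  qed
  show ?thesis
  proof (intro conjI allI impI)
    fix p :: "real \<Rightarrow> real"
    assume "(\<forall>x. p (x + T) = p x) \<and> p absolutely_integrable_on {0..T} \<and>
            (\<lambda>l. cmod (fcoef T p l) * rho \<tau>0 l) summable_on (UNIV :: int set)"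
    then have sm: "(\<lambda>l. cmod (fcoef T p l) * rho \<tau>0 l) summable_on UNIV" by blast
    show "trace_class_analytic_on (Hmat T p) (Kset T \<tau>0 0)"
    proof (rule trace_class_analytic_onI)
      fix s assume "s \<in> Kset T \<tau>0 0"
      then obtain r d where rd: "r > 0" "d > 0" "ball s r \<subseteq> Kset T \<tau>0 d"
        by (rule ball_subset_Kset)
      \<comment> \<open>Analyticity is local, so the constant may depend on \<open>s\<close>;
        \<open>Re\<close> is bounded on the ball and the shift \<open>j = 0\<close> is
        enough.\<close>
      have "\<bar>Re s\<bar> + r \<ge> 0" using rd by simp
      from cmod_Beta_le_majorant[OF assms rd(2) this] obtain C where C: "C > 0"
        "\<And>s' j n m. \<lbrakk>s' \<in> Kset T \<tau>0 d; \<bar>Re s' - omega T * of_int j\<bar> \<le> \<bar>Re s\<bar> + r\<rbrakk> \<Longrightarrow>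
          cmod (Beta (1/2 - \<i> * of_real (omega T) * of_int n - \<i> * s')
                     (1/2 + \<i> * of_real (omega T) * of_int m + \<i> * s'))
           \<le> C * beta_majorant c \<tau>0 (n + j) (m + j)"
        unfolding c_def by blast
      define B where "B n m = C * beta_majorant c \<tau>0 (n + 0) (m + 0) * cmod (fcoef T p (n - m))" for n m
      have hol: "(\<lambda>z. Hmat T p z n m) holomorphic_on ball s r" for n m
        using Hmat_holomorphic_on_Kset[OF rd(2)] rd(3) by (rule holomorphic_on_subset)
      have bd: "cmod (Hmat T p z n m) \<le> B n m" if z: "z \<in> ball s r" for n m z
      proof -
        have "\<bar>Re s - Re z\<bar> < r"
          using z abs_Re_le_cmod[of "s - z"] by (simp add: dist_norm)
        then have "\<bar>Re z - omega T * of_int 0\<bar> \<le> \<bar>Re s\<bar> + r" by simp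
        moreover have "z \<in> Kset T \<tau>0 d" using z rd(3) by blast
        ultimately show ?thesis
          unfolding Hmat_def norm_mult B_def by (intro mult_right_mono C(2)) auto
      qed
      have sum: "(\<Sum>(n,m)\<in>F. B n m) \<le> C * D * (\<Sum>\<^sub>\<infinity>l. cmod (fcoef T p l) * rho \<tau>0 l)"
        if "finite F" for F
        unfolding B_def using sm that C(1) by (rule majorant_sum)
      show "\<exists>r>0. \<exists>B K. (\<forall>n m. (\<lambda>z. Hmat T p z n m) holomorphic_on ball s r) \<and>
          (\<forall>n m. \<forall>z\<in>ball s r. cmod (Hmat T p z n m) \<le> B n m) \<and>
          (\<forall>F. finite F \<longrightarrow> (\<Sum>(n,m)\<in>F. B n m) \<le> K)"
        using rd(1) hol bd sum by blast
    qed
  next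
    fix \<delta> :: real assume \<delta>: "\<delta> > 0"
    \<comment> \<open>Here the constant must serve all \<open>s\<close> and all \<open>p\<close>;
      the remainder bound is therefore the period \<open>w\<close> of the lattice and not a bound on
      \<open>Re s\<close>.\<close>
    from cmod_Beta_le_majorant[OF assms \<delta> less_imp_le[OF w]] obtain C where C: "C > 0"
      "\<And>s j n m. \<lbrakk>s \<in> Kset T \<tau>0 \<delta>; \<bar>Re s - omega T * of_int j\<bar> \<le> w\<rbrakk> \<Longrightarrow>
        cmod (Beta (1/2 - \<i> * of_real (omega T) * of_int n - \<i> * s)
                   (1/2 + \<i> * of_real (omega T) * of_int m + \<i> * s))
         \<le> C * beta_majorant c \<tau>0 (n + j) (m + j)"
      unfolding c_def by blast
    show "\<exists>C :: real. \<forall>p :: real \<Rightarrow> real.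
            (\<forall>x. p (x + T) = p x) \<and> p absolutely_integrable_on {0..T} \<and>
            (\<lambda>l. cmod (fcoef T p l) * rho \<tau>0 l) summable_on (UNIV :: int set)
            \<longrightarrow> (\<forall>s\<in>Kset T \<tau>0 \<delta>.
                  trace_norm (Hmat T p s)
                    \<le> ereal (C * (\<Sum>\<^sub>\<infinity>l\<in>(UNIV :: int set). cmod (fcoef T p l) * rho \<tau>0 l)))"
    proof (intro exI allI impI ballI)
      fix p :: "real \<Rightarrow> real" and s
      assume "(\<forall>x. p (x + T) = p x) \<and> p absolutely_integrable_on {0..T} \<and>
            (\<lambda>l. cmod (fcoef T p l) * rho \<tau>0 l) summable_on (UNIV :: int set)"
        and s: "s \<in> Kset T \<tau>0 \<delta>"
      then have sm: "(\<lambda>l. cmod (fcoef T p l) * rho \<tau>0 l) summable_on UNIV" by blast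
      \<comment> \<open>A common shift of rows and columns by \<open>j\<close> reduces
        \<open>Re s\<close> modulo \<open>w\<close>.\<close>
      define j where "j = \<lfloor>Re s / w\<rfloor>"
      have "of_int j \<le> Re s / w" "Re s / w \<le> of_int j + 1" unfolding j_def by linarith+
      then have "w * of_int j \<le> Re s" "Re s \<le> w * of_int j + w"
        using w by (simp_all add: field_simps)
      then have j: "\<bar>Re s - omega T * of_int j\<bar> \<le> w" by (simp add: w_def)
      show "trace_norm (Hmat T p s) \<le> ereal (C * D * (\<Sum>\<^sub>\<infinity>l. cmod (fcoef T p l) * rho \<tau>0 l))"
      proof (rule trace_norm_le_entrywise)
        fix F :: "(int \<times> int) set" assume F: "finite F"
        have "(\<Sum>(n,m)\<in>F. cmod (Hmat T p s n m)) \<le>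
            (\<Sum>(n,m)\<in>F. C * beta_majorant c \<tau>0 (n + j) (m + j) * cmod (fcoef T p (n - m)))"
          unfolding Hmat_def norm_mult case_prod_beta
          by (intro sum_mono mult_right_mono C(2) s j) auto
        also have "\<dots> \<le> C * D * (\<Sum>\<^sub>\<infinity>l. cmod (fcoef T p l) * rho \<tau>0 l)"
          using sm F C(1) by (rule majorant_sum)
        finally show "(\<Sum>(n,m)\<in>F. cmod (Hmat T p s n m)) \<le> C * D * (\<Sum>\<^sub>\<infinity>l. cmod (fcoef T p l) * rho \<tau>0 l)" .
      qed
    qed
  qed
qed

end
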